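(* Let $T$ be either $\left(-\frac9{23},-\frac1{23}\right)$ or $\left(-\frac1{23},\frac7{23}\right)$, and let $h$ be absolutely monotone with $h^{(4)}>0$ (on $(-1,1)$). Then for every $T$-avoiding code $C\subset\mathbb{S}^{22}$ with $2048$ points, $$E_h(C)\ \ge\ \mathcal{E}_h(23,2048;T)=2048\left(253\,h\!\left(-\tfrac9{23}\right)+1288\,h\!\left(-\tfrac1{23}\right)+506\,h\!\left(\tfrac7{23}\right)\right).$$ Consequently, the code $C_G$ is universally optimal in the class of such $T$-avoiding spherical codes on $\mathbb{S}^{22}$. If equality $E_h(C)=\mathcal{E}_h(23,2048;T)$ is attained for any other code $C$, then $C$ has to be a spherical $3$-design with the same inner products and distance distribution as $C_G$, namely $I(C)=\{-\frac9{23},-\frac1{23},\frac7{23}\}$ and distance distribution $(253,1288,506)$.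
   Context: A spherical code is a finite set $C\subset\mathbb{S}^{n-1}$; $I(C)=\{x\cdot y: x,y\in C,\ x\ne y\}$. For $T\subset[-1,1)$, $C$ is $T$-avoiding if $I(C)\cap T=\varnothing$. A spherical $\tau$-design is a spherical code $C$ such that the average over $C$ of every polynomial in $n$ variables of total degree at most $\tau$ equals its average over $\mathbb{S}^{n-1}$ with respect to normalized surface measure. A potential is a function $h:[-1,1)\to(-\infty,+\infty)$, continuous on $[-1,1)$; it is absolutely monotone if $h^{(j)}\ge0$ for all $j\ge1$ (on $(-1,1)$). The $h$-energy is $E_h(C)=\sum_{x\neq y\in C}h(x\cdot y)$ (sum over ordered pairs). $\mathcal{E}_h(n,N;T)$ is the minimum of $E_h(C)$ over all $T$-avoiding spherical codes $C\subset\mathbb{S}^{n-1}$ with $|C|=N$. For $T$ open, a code $C\subset\mathbb{S}^{n-1}$ is $T$-avoiding universally optimal if it is $T$-avoiding and, for every absolutely monotone $h$, it minimizes $E_h$ among all $T$-avoiding codes on $\mathbb{S}^{n-1}$ of cardinality $|C|$. The distance distribution of a distance-invariant code $C$ (one for which $A_t=|\{y\in C: x\cdot y=t\}|$ is independent of $x\in C$ for each $t\in I(C)$) is the tuple $(A_t)$ listed in increasing order of $t\in I(C)$. The code $C_G\subset\mathbb{S}^{22}$ is the image of the orthogonal complement (dual) of the binary Golay code of length $23$ (a binary linear code of length $23$ with $2^{11}=2048$ codewords, nonzero weights $8,12,16$) under the standard mapping $(c_1,\dots,c_{23})\mapsto\frac1{\sqrt{23}}\left((-1)^{c_1},\dots,(-1)^{c_{23}}\right)$.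 Its inner products $-\frac9{23},-\frac1{23},\frac7{23}$ correspond to Hamming distances $16,12,8$, and its distance distribution is $(253,1288,506)$. *)

theory Defs
  imports "HOL-Analysis.Analysis" "HOL-Library.Z2"
begin

definition spherical_code :: "(real ^ 'n) set \<Rightarrow> bool" where
  "spherical_code C \<longleftrightarrow> finite C \<and> C \<subseteq> sphere 0 1"

definition inner_products :: "(real ^ 'n) set \<Rightarrow> real set" where
  "inner_products C = {x \<bullet> y | x y. x \<in> C \<and> y \<in> C \<and> x \<noteq> y}"

definition avoiding :: "real set \<Rightarrow> (real ^ 'n) set \<Rightarrow> bool" where
  "avoiding T C \<longleftrightarrow> inner_products C \<inter> T = {}"

definition distance_invariant :: "(real ^ 'n) set \<Rightarrow> bool" where
  "distance_invariant C \<longleftrightarrow>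
     (\<forall>t \<in> inner_products C. \<forall>x \<in> C. \<forall>x' \<in> C.
        card {y \<in> C. x \<bullet> y = t} = card {y \<in> C. x' \<bullet> y = t})"

text \<open>For nonempty \<open>C\<close> at most one list \<open>As\<close> satisfies this predicate; its entries follow the
  inner products of \<open>C\<close> in increasing order.\<close>

definition has_distance_distribution :: "(real ^ 'n) set \<Rightarrow> nat list \<Rightarrow> bool" where
  "has_distance_distribution C As \<longleftrightarrow>
     distance_invariant C \<and>
     (\<forall>x \<in> C. map (\<lambda>t. card {y \<in> C. x \<bullet> y = t}) (sorted_list_of_set (inner_products C)) = As)"

text \<open>The index set of the sum is finite because the index type is.\<close>

definition polynomial_of_degree_le :: "nat \<Rightarrow> (real ^ 'n \<Rightarrow> real) \<Rightarrow> bool" where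
  "polynomial_of_degree_le d p \<longleftrightarrow>
     (\<exists>c :: ('n \<Rightarrow> nat) \<Rightarrow> real. \<forall>x.
        p x = (\<Sum>\<alpha> | (\<Sum>i\<in>UNIV. \<alpha> i) \<le> d. c \<alpha> * (\<Prod>i\<in>UNIV. (x $ i) ^ \<alpha> i)))"

text \<open>Normalized surface measure of the unit sphere, as a Borel measure on the whole space: a set
  \<open>A\<close> of unit vectors receives the relative volume in the unit ball of the cone over \<open>A\<close>
  (polar coordinates). The origin, which is mapped to itself, is a null set.\<close>

definition sphere_measure :: "(real ^ 'n) measure" where
  "sphere_measure = distr (uniform_measure lborel (ball 0 1)) borel (\<lambda>x. x /\<^sub>R norm x)"

definition spherical_design :: "nat \<Rightarrow> (real ^ 'n) set \<Rightarrow> bool" where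
  "spherical_design d C \<longleftrightarrow>
     spherical_code C \<and>
     (\<forall>p. polynomial_of_degree_le d p \<longrightarrow>
        (\<Sum>x\<in>C. p x) / real (card C) = (\<integral>x. p x \<partial>sphere_measure))"

text \<open>Potentials live on \<open>[-1,1)\<close>; their values elsewhere are never used. In particular
  \<open>deriv\<close> is only taken at interior points, where it depends on nearby values only.\<close>

definition potential :: "(real \<Rightarrow> real) \<Rightarrow> bool" where
  "potential h \<longleftrightarrow> continuous_on {-1..<1} h"

definition absolutely_monotone :: "(real \<Rightarrow> real) \<Rightarrow> bool" where
  "absolutely_monotone h \<longleftrightarrow>
     potential h \<and>
     (\<forall>j. \<forall>t\<in>{-1<..<1}. (deriv ^^ j) h differentiable (at t)) \<and>
     (\<forall>j\<ge>1. \<forall>t\<in>{-1<..<1}. (deriv ^^ j) h t \<ge> 0)"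

definition energy :: "(real \<Rightarrow> real) \<Rightarrow> (real ^ 'n) set \<Rightarrow> real" where
  "energy h C = (\<Sum>(x, y) \<in> {(x, y). x \<in> C \<and> y \<in> C \<and> x \<noteq> y}. h (x \<bullet> y))"

text \<open>The first argument only carries the dimension \<open>CARD('n)\<close> of the ambient space.\<close>

definition min_energy :: "'n::finite itself \<Rightarrow> (real \<Rightarrow> real) \<Rightarrow> nat \<Rightarrow> real set \<Rightarrow> real" where
  "min_energy n h N T =
     (LEAST e. \<exists>C :: (real ^ 'n) set.
        spherical_code C \<and> avoiding T C \<and> card C = N \<and> e = energy h C)"

definition universally_optimal :: "real set \<Rightarrow> (real ^ 'n) set \<Rightarrow> bool" where
  "universally_optimal T C \<longleftrightarrow>
     spherical_code C \<and> avoiding T C \<and>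
     (\<forall>h. absolutely_monotone h \<longrightarrow>
        (\<forall>D :: (real ^ 'n) set. spherical_code D \<and> avoiding T D \<and> card D = card C \<longrightarrow>
           energy h C \<le> energy h D))"

text \<open>The binary Golay code (unique up to equivalence) as the cyclic code of length 23 generated by
  \<open>1 + X\<^sup>2 + X\<^sup>4 + X\<^sup>5 + X\<^sup>6 + X\<^sup>1\<^sup>0 + X\<^sup>1\<^sup>1\<close>.
  Indices have the type \<open>23\<close>, whose arithmetic is modulo 23, so \<open>i - k\<close> is a cyclic shift.\<close>

definition golay_code :: "(bit ^ 23) set" where
  "golay_code = vec.span (range (\<lambda>k. \<chi> i. if i - k \<in> {0, 2, 4, 5, 6, 10, 11} then 1 else 0))"

definition dual_code :: "(bit ^ 'n) set \<Rightarrow> (bit ^ 'n) set" where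
  "dual_code G = {c. \<forall>g\<in>G. (\<Sum>i\<in>UNIV. c $ i * g $ i) = 0}"

definition sphere_embed :: "bit ^ 'n \<Rightarrow> real ^ 'n" where
  "sphere_embed c = (\<chi> i. (if c $ i = 1 then - 1 else 1) / sqrt (real CARD('n)))"

definition C_G :: "(real ^ 23) set" where
  "C_G = sphere_embed ` dual_code golay_code"

end

theory Submission
  imports Defs "HOL-Computational_Algebra.Polynomial" "HOL-Probability.Probability_Measure"
begin

text \<open>Linear programming (Delsarte--Yudin) bound. Interpolate \<open>h\<close> by a cubic \<open>f\<close> at the three inner
  products, with a double node at the one that is not an endpoint of \<open>T\<close>. By Rolle, \<open>h - f\<close> is a
  nonnegative multiple of a quartic that is nonnegative off \<open>T\<close>, and the Newton coefficients of \<open>f\<close>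
  are divided differences of \<open>h\<close>, hence nonnegative. Since the Newton basis polynomials have
  nonnegative Gegenbauer coefficients in dimension 23, the energy of \<open>f\<close> is at least its value on
  \<open>C_G\<close>. If \<open>h\<close> has positive fourth derivative, then equality forces all inner products to be nodes
  and all harmonic moments of degrees 1, 2, 3 to vanish; the latter is the 3-design property, and
  the moments of degrees 0, 1, 2 determine the distance distribution. The weights of the dual Golay
  code are counted by enumerating its 2048 words.\<close>

section \<open>The dual Golay code\<close>

text \<open>Both intervals give the same bound because \<open>-1/23\<close> ends each of them: only
  the doubled node changes, and with it only the cubic Newton coefficient. The value comes from a
  quadrature rule: the weights 1, 253, 1288, 506 at 1, \<open>-9/23\<close>, \<open>-1/23\<close>,
  \<open>7/23\<close> have moments 2048, 0, 2048/23, 0 of orders 0 to 3, which are 2048 times those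
  of one coordinate on the sphere. The fourth moments differ, so interpolation stops at degree 3.
  Positive definiteness is not taken from a general theorem. The kernels of degrees 1, 2, 3 are
  written as explicit sums of products of entries of trace-free tensors, so their double sums over a
  code are sums of squares. In the equality case the squares vanish one by one, which gives every
  coordinate moment up to degree 3 and hence the design property. A potential is only continuous at
  -1 and may be unbounded near 1. Rolle is therefore run on a closed interval that ends before 1,
  with derivatives taken in its interior only.\<close>

lemma of_nat_23_less:
  assumes "i < j" "j < 23"
  shows "(of_nat i :: 23) \<noteq> of_nat j"
proof
  assume "(of_nat i :: 23) = of_nat j"
  then have "(of_nat (j - i) :: 23) = 0"
    using assms by (simp add: of_nat_diff)
  then have "CHAR(23) dvd j - i"
    by (simp only: of_nat_eq_0_iff_char_dvd)
  then have "23 dvd j - i" by simp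
  with assms show False using dvd_imp_le[of 23 "j - i"] by linarith
qed

lemma bij_betw_of_nat_23: "bij_betw (of_nat :: nat \<Rightarrow> 23) {..<23} UNIV"
proof -
  have inj: "inj_on (of_nat :: nat \<Rightarrow> 23) {..<23}"
    by (rule linorder_inj_onI') (use of_nat_23_less in force)
  then have "card ((of_nat :: nat \<Rightarrow> 23) ` {..<23}) = CARD(23)"
    by (simp add: card_image)
  then have "(of_nat :: nat \<Rightarrow> 23) ` {..<23} = UNIV"
    by (intro card_subset_eq) auto
  with inj show ?thesis by (simp add: bij_betw_def)
qed

text \<open>Residues modulo 23 carry the cyclic shifts, list positions 0 to 22 carry the
  computations; this is the passage from the former to the latter.\<close>

definition index_of :: "23 \<Rightarrow> nat" where
  "index_of = inv_into {..<23} of_nat"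

lemma index_of_of_nat: "k < 23 \<Longrightarrow> index_of (of_nat k) = k"
  unfolding index_of_def
  using bij_betw_of_nat_23 by (auto simp: bij_betw_def intro!: inv_into_f_f)

lemma of_nat_index_of: "of_nat (index_of i) = i"
  unfolding index_of_def
  using bij_betw_of_nat_23 by (auto simp: bij_betw_def intro!: f_inv_into_f)

lemma index_of_less: "index_of i < 23"
  unfolding index_of_def
  using bij_betw_of_nat_23 inv_into_into[of i of_nat "{..<23}"] by (auto simp: bij_betw_def)

lemma of_nat_23_mod: "(of_nat (k mod 23) :: 23) = of_nat k"
proof -
  have "(of_nat k :: 23) = of_nat (k mod 23 + 23 * (k div 23))" by simp
  also have "\<dots> = of_nat (k mod 23) + 23 * of_nat (k div 23)" by (simp only: of_nat_add of_nat_mult of_nat_numeral)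
  also have "(23 :: 23) = 0" by simp
  finally show ?thesis by simp
qed

lemma index_of_of_nat_mod: "index_of (of_nat k) = k mod 23"
  using index_of_of_nat[of "k mod 23"] by (simp add: of_nat_23_mod)

lemma vec23_eqI: "(\<And>k. k < 23 \<Longrightarrow> x $ of_nat k = y $ of_nat k) \<Longrightarrow> x = (y :: 'a ^ 23)"
  unfolding vec_eq_iff using of_nat_index_of index_of_less by metis

section \<open>Parity checks of the dual code\<close>

lemma dual_code_add: "c \<in> dual_code G \<Longrightarrow> d \<in> dual_code G \<Longrightarrow> c + d \<in> dual_code G"
  unfolding dual_code_def by (auto simp: distrib_right sum.distrib simp del: add_bit_eq_xor mult_bit_eq_and)

lemma dual_code_span:
  fixes B :: "(bit ^ 'n) set"
  shows "dual_code (vec.span B) = dual_code B"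
proof
  show "dual_code (vec.span B) \<subseteq> dual_code B"
    unfolding dual_code_def using vec.span_superset[of B] by auto
  show "dual_code B \<subseteq> dual_code (vec.span B)"
  proof
    fix c assume c: "c \<in> dual_code B"
    have "(\<Sum>i\<in>UNIV. c $ i * g $ i) = 0" if "g \<in> vec.span B" for g
      using that
    proof (induction rule: vec.span_induct_alt)
      case base
      then show ?case by (simp del: add_bit_eq_xor mult_bit_eq_and)
    next
      case (step a x y)
      have "(\<Sum>i\<in>UNIV. c $ i * (a *s x + y) $ i)
          = a * (\<Sum>i\<in>UNIV. c $ i * x $ i) + (\<Sum>i\<in>UNIV. c $ i * y $ i)"
        by (simp add: algebra_simps sum.distrib sum_distrib_left del: add_bit_eq_xor mult_bit_eq_and)
      then show ?case
        using step c by (simp add: dual_code_def del: add_bit_eq_xor mult_bit_eq_and)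
    qed
    then show "c \<in> dual_code (vec.span B)" by (simp add: dual_code_def)
  qed
qed

text \<open>Orthogonality need only be tested on the 23 cyclic shifts that span the code;
  substituting \<open>i = k + d\<close> turns each test into a sum over the exponents of the
  generator polynomial.\<close>

lemma mem_dual_golay_iff:
  "c \<in> dual_code golay_code \<longleftrightarrow>
     (\<forall>k. (\<Sum>d\<leftarrow>[0, 2, 4, 5, 6, 10, 11]. c $ (k + of_nat d)) = 0)"
proof -
  have "(\<Sum>i\<in>UNIV. c $ i * (\<chi> i. if i - k \<in> {0, 2, 4, 5, 6, 10, 11} then 1 else 0) $ i)
      = (\<Sum>d\<leftarrow>[0, 2, 4, 5, 6, 10, 11]. c $ (k + of_nat d))" for k
  proof -
    have "(\<Sum>i\<in>UNIV. c $ i * (\<chi> i. if i - k \<in> {0, 2, 4, 5, 6, 10, 11} then 1 else 0) $ i)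
        = (\<Sum>i | i - k \<in> {0, 2, 4, 5, 6, 10, 11}. c $ i)"
      by (rule sum.mono_neutral_cong_right) auto
    also have "\<dots> = (\<Sum>d\<in>{0, 2, 4, 5, 6, 10, 11}. c $ (k + d))"
      by (rule sum.reindex_bij_witness[where i = "\<lambda>d. k + d" and j = "\<lambda>i. i - k"]) auto
    also have "\<dots> = (\<Sum>d\<leftarrow>[0, 2, 4, 5, 6, 10, 11]. c $ (k + of_nat d))"
      by (simp del: add_bit_eq_xor)
    finally show ?thesis .
  qed
  then show ?thesis
    unfolding golay_code_def dual_code_span unfolding dual_code_def by auto
qed

text \<open>The parity checks form a linear recurrence of order 11.\<close>

lemma dual_golay_eq_0:
  assumes "c \<in> dual_code golay_code" "\<And>k. k < 11 \<Longrightarrow> c $ of_nat k = 0"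
  shows "c = 0"
proof -
  have "c $ of_nat k = 0" for k
  proof (induction k rule: less_induct)
    case (less k)
    show ?case
    proof (cases "k < 11")
      case False
      \<comment> \<open>The check at shift \<open>m\<close> involves \<open>m + 11 = k\<close> and
        otherwise only positions from \<open>m\<close> to \<open>m + 10\<close>. Those vanish by
        induction, which forces position \<open>k\<close> to vanish.\<close>
      then obtain m where m: "k = m + 11" by (metis add.commute le_Suc_ex not_less)
      have "(\<Sum>d\<leftarrow>[0, 2, 4, 5, 6, 10, 11]. c $ (of_nat m + of_nat d)) = 0"
        using assms(1) unfolding mem_dual_golay_iff by blast
      then have "(\<Sum>d\<leftarrow>[0, 2, 4, 5, 6, 10, 11]. c $ (of_nat (m + d))) = 0"
        by (simp only: of_nat_add)
      moreover have "c $ of_nat (m + d) = 0" if "d < 11" for d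
        using less.IH[of "m + d"] that m by simp
      then have "c $ of_nat (m + d) = 0" if "d \<in> {0, 2, 4, 5, 6, 10}" for d
        by (rule) (use that in auto)
      moreover have "c $ of_nat m = 0"
        using less.IH[of m] m by simp
      ultimately show ?thesis using m
        by (simp only: empty_iff list.map sum_list.Cons sum_list.Nil insert_iff simp_thms add_0_left add_0_right)
    qed (use assms(2) in auto)
  qed
  then show ?thesis by (intro vec23_eqI) simp
qed

section \<open>Systematic enumeration of the dual code\<close>

definition vec_of :: "bool list \<Rightarrow> bit ^ 23" where
  "vec_of xs = (\<chi> i. of_bool (xs ! index_of i))"

definition xor_list :: "bool list \<Rightarrow> bool list \<Rightarrow> bool list" where
  "xor_list = map2 (\<noteq>)"

lemma length_xor_list [simp]: "length (xor_list xs ys) = min (length xs) (length ys)"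
  by (simp add: xor_list_def)

lemma nth_xor_list [simp]:
  "k < length xs \<Longrightarrow> k < length ys \<Longrightarrow> xor_list xs ys ! k \<longleftrightarrow> xs ! k \<noteq> ys ! k"
  by (simp add: xor_list_def)

lemma vec_of_xor_list:
  "length xs = 23 \<Longrightarrow> length ys = 23 \<Longrightarrow> vec_of (xor_list xs ys) = vec_of xs + vec_of ys"
  by (auto simp: vec_of_def vec_eq_iff index_of_less)

fun combine :: "bool list \<Rightarrow> bool list \<Rightarrow> bool list list \<Rightarrow> bool list" where
  "combine acc (b # bs) (r # rs) = combine (if b then xor_list acc r else acc) bs rs"
| "combine acc _ _ = acc"

text \<open>Walks the binary tree of row choices and shares partial sums, so that all 2048 words
  together cost 2047 additions.\<close>

fun weight_count :: "nat \<Rightarrow> bool list \<Rightarrow> bool list list \<Rightarrow> nat" where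
  "weight_count w acc [] = (if count_list acc True = w then 1 else 0)"
| "weight_count w acc (r # rs) = weight_count w acc rs + weight_count w (xor_list acc r) rs"

text \<open>The two recursive calls correspond to coefficient lists starting with
  \<open>False\<close> and with \<open>True\<close>, two disjoint classes.\<close>

lemma weight_count_eq_card:
  "weight_count w acc rs
     = card {bs. length bs = length rs \<and> count_list (combine acc bs rs) True = w}"
proof (induction rs arbitrary: acc)
  case Nil
  have "{bs. length bs = length ([] :: bool list list) \<and> count_list (combine acc bs []) True = w}
      = (if count_list acc True = w then {[]} else {})"
    by auto
  then show ?case by simp
next
  case (Cons r rs)
  let ?S = "\<lambda>a. {bs. length bs = length rs \<and> count_list (combine a bs rs) True = w}"
  have fin: "finite (?S a)" for a
    by (rule finite_subset[OF _ finite_lists_length_eq[of "UNIV :: bool set" "length rs"]]) auto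
  have "{bs. length bs = length (r # rs) \<and> count_list (combine acc bs (r # rs)) True = w}
      = Cons False ` ?S acc \<union> Cons True ` ?S (xor_list acc r)" (is "?L = ?R")
  proof (rule set_eqI)
    fix bs show "bs \<in> ?L \<longleftrightarrow> bs \<in> ?R"
    proof (cases bs)
      case (Cons b bs')
      then show ?thesis by (cases b) (auto simp: image_iff)
    qed auto
  qed
  then show ?case
    using fin Cons.IH
    by (simp, subst card_Un_disjoint) (auto simp: card_image)
qed

text \<open>Row \<open>j\<close> continues the \<open>j\<close>-th unit vector of length 11 by the recurrence of the dual code.\<close>

definition golay_rows :: "bool list list" where
  "golay_rows =
    map (map (\<lambda>b. b = 1)) ([
     [1,0,0,0,0,0,0,0,0,0,0,1,1,1,1,1,0,0,1,0,0,1,0],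
     [0,1,0,0,0,0,0,0,0,0,0,0,1,1,1,1,1,0,0,1,0,0,1],
     [0,0,1,0,0,0,0,0,0,0,0,1,1,0,0,0,1,1,1,0,1,1,0],
     [0,0,0,1,0,0,0,0,0,0,0,0,1,1,0,0,0,1,1,1,0,1,1],
     [0,0,0,0,1,0,0,0,0,0,0,1,1,0,0,1,0,0,0,1,1,1,1],
     [0,0,0,0,0,1,0,0,0,0,0,1,0,0,1,1,1,0,1,0,1,0,1],
     [0,0,0,0,0,0,1,0,0,0,0,1,0,1,1,0,1,1,1,1,0,0,0],
     [0,0,0,0,0,0,0,1,0,0,0,0,1,0,1,1,0,1,1,1,1,0,0],
     [0,0,0,0,0,0,0,0,1,0,0,0,0,1,0,1,1,0,1,1,1,1,0],
     [0,0,0,0,0,0,0,0,0,1,0,0,0,0,1,0,1,1,0,1,1,1,1],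
     [0,0,0,0,0,0,0,0,0,0,1,1,1,1,1,0,0,1,0,0,1,0,1]] :: nat list list)"

lemma length_golay_rows: "length golay_rows = 11" "r \<in> set golay_rows \<Longrightarrow> length r = 23"
  by (auto simp: golay_rows_def)

text \<open>On a single coordinate the combination is a fold of booleans, which can be evaluated for
  concrete rows and symbolic coefficients.\<close>

lemma combine_nth:
  assumes "k < length acc" "\<forall>r\<in>set rs. length r = length acc"
  shows "combine acc bs rs ! k = fold (\<lambda>(b, r) a. a \<noteq> (b \<and> r ! k)) (zip bs rs) (acc ! k)"
  using assms
proof (induction acc bs rs rule: combine.induct)
  case (1 acc b bs r rs)
  then show ?case by (cases b) auto
qed auto

lemma length_combine:
  assumes "\<forall>r\<in>set rs. length r = length acc"
  shows "length (combine acc bs rs) = length acc"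
  using assms by (induction acc bs rs rule: combine.induct) auto

text \<open>The first 11 columns of \<open>golay_rows\<close> form the identity matrix, so the
  encoding is systematic.\<close>

lemma combine_golay_rows_nth:
  assumes "length bs = 11" "k < 11"
  shows "combine (replicate 23 False) bs golay_rows ! k = bs ! k"
proof -
  have "combine (replicate 23 False) bs golay_rows ! k
      = fold (\<lambda>(b, r) a. a \<noteq> (b \<and> r ! k)) (zip bs golay_rows) (replicate 23 False ! k)"
    using assms by (intro combine_nth) (auto simp: length_golay_rows)
  moreover obtain b0 b1 b2 b3 b4 b5 b6 b7 b8 b9 b10
    where "bs = [b0, b1, b2, b3, b4, b5, b6, b7, b8, b9, b10]"
    using assms(1) by (auto simp: numeral_eq_Suc length_Suc_conv)
  moreover have "k \<in> {0, 1, 2, 3, 4, 5, 6, 7, 8, 9, 10}"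
    unfolding insert_iff empty_iff using assms(2) by arith
  ultimately show ?thesis
    unfolding golay_rows_def by (elim insertE) simp_all
qed

lemma of_nat_bit_eq_0_iff: "(of_nat n :: bit) = 0 \<longleftrightarrow> even n"
  by (induction n) (auto simp del: add_bit_eq_xor)

text \<open>Rewrites the checks over \<open>bit\<close> as parities of counts over list positions, a
  condition that can be evaluated.\<close>

lemma vec_of_mem_dual_golay:
  assumes "\<forall>j\<in>set [0..<23]. even (length (filter (\<lambda>d. xs ! ((j + d) mod 23)) [0, 2, 4, 5, 6, 10, 11]))"
  shows "vec_of xs \<in> dual_code golay_code"
  unfolding mem_dual_golay_iff
proof
  fix k :: 23
  have "(\<Sum>d\<leftarrow>ds. (of_bool (P d) :: bit)) = of_nat (length (filter P ds))" for ds :: "nat list" and P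
    by (induction ds) (auto simp del: add_bit_eq_xor)
  then have "(\<Sum>d\<leftarrow>ds. vec_of xs $ (k + of_nat d))
      = of_nat (length (filter (\<lambda>d. xs ! ((index_of k + d) mod 23)) ds))" for ds
    using of_nat_index_of[of k]
    by (metis (no_types, lifting) vec_of_def vec_lambda_beta index_of_of_nat_mod of_nat_add map_eq_conv)
  then show "(\<Sum>d\<leftarrow>[0, 2, 4, 5, 6, 10, 11]. vec_of xs $ (k + of_nat d)) = 0"
    using assms index_of_less[of k] by (simp only: of_nat_bit_eq_0_iff atLeastLessThan_iff set_upt) auto
qed

lemma golay_rows_mem: "r \<in> set golay_rows \<Longrightarrow> vec_of r \<in> dual_code golay_code"
proof (rule vec_of_mem_dual_golay)
  have "\<forall>r\<in>set golay_rows. \<forall>j\<in>set [0..<23].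
      even (length (filter (\<lambda>d. r ! ((j + d) mod 23)) [0, 2, 4, 5, 6, 10, 11]))"
    by code_simp
  then show "r \<in> set golay_rows \<Longrightarrow> \<forall>j\<in>set [0..<23].
      even (length (filter (\<lambda>d. r ! ((j + d) mod 23)) [0, 2, 4, 5, 6, 10, 11]))"
    by blast
qed

lemma combine_mem_dual_golay:
  assumes "vec_of acc \<in> dual_code golay_code" "length acc = 23" "set rs \<subseteq> set golay_rows"
  shows "vec_of (combine acc bs rs) \<in> dual_code golay_code"
  using assms
proof (induction acc bs rs rule: combine.induct)
  case (1 acc b bs r rs)
  then have "vec_of (if b then xor_list acc r else acc) \<in> dual_code golay_code"
    using length_golay_rows(2) golay_rows_mem by (auto simp: vec_of_xor_list dual_code_add)
  then show ?case
    using 1 length_golay_rows(2) by (cases b) auto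
qed auto

abbreviation encode :: "bool list \<Rightarrow> bit ^ 23" where
  "encode bs \<equiv> vec_of (combine (replicate 23 False) bs golay_rows)"

lemma encode_nth: "length bs = 11 \<Longrightarrow> k < 11 \<Longrightarrow> encode bs $ of_nat k = of_bool (bs ! k)"
  by (simp add: vec_of_def index_of_of_nat combine_golay_rows_nth)

lemma encode_mem: "encode bs \<in> dual_code golay_code"
proof -
  have "vec_of (replicate 23 False) = 0"
    by (simp add: vec_of_def vec_eq_iff index_of_less)
  then have "vec_of (replicate 23 False) \<in> dual_code golay_code"
    by (simp add: dual_code_def)
  then show ?thesis by (intro combine_mem_dual_golay) auto
qed

lemma vec_bit_add_self: "c + c = (0 :: bit ^ 'n)"
  by (simp add: vec_eq_iff)

text \<open>Injective because the message is read off the first 11 coordinates; onto because the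
  recurrence determines a dual word from those coordinates.\<close>

lemma bij_betw_encode: "bij_betw encode {bs. length bs = 11} (dual_code golay_code)"
  unfolding bij_betw_def
proof
  show "inj_on encode {bs. length bs = 11}"
  proof (rule inj_onI)
    fix bs bs' assume *: "bs \<in> {bs. length bs = 11}" "bs' \<in> {bs. length bs = 11}" "encode bs = encode bs'"
    then have "(of_bool (bs ! k) :: bit) = of_bool (bs' ! k)" if "k < 11" for k
      using encode_nth[of bs k] encode_nth[of bs' k] that by simp
    then have "bs ! k = bs' ! k" if "k < 11" for k
      using that by (metis of_bool_eq_iff)
    then show "bs = bs'" using *(1,2) by (intro nth_equalityI) simp_all
  qed
  show "encode ` {bs. length bs = 11} = dual_code golay_code"
  proof
    show "dual_code golay_code \<subseteq> encode ` {bs. length bs = 11}"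
    proof
      fix c assume c: "c \<in> dual_code golay_code"
      define bs where "bs = map (\<lambda>k. c $ of_nat k = 1) [0..<11]"
      \<comment> \<open>In characteristic 2 this sum is the difference of two dual words that agree
        on the first 11 coordinates.\<close>
      have "c + encode bs = 0"
      proof (rule dual_golay_eq_0)
        show "c + encode bs \<in> dual_code golay_code"
          using c encode_mem by (rule dual_code_add)
        fix k :: nat assume "k < 11"
        then have "encode bs $ of_nat k = c $ of_nat k"
          by (simp add: encode_nth bs_def)
        then show "(c + encode bs) $ of_nat k = 0" by simp
      qed
      then have "(c + encode bs) + encode bs = encode bs" by (simp only: add_0_left)
      then have "c = encode bs"
        by (simp only: add.assoc vec_bit_add_self add_0_right)
      then show "c \<in> encode ` {bs. length bs = 11}" by (auto simp: bs_def)
    qed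
  qed (use encode_mem in auto)
qed

section \<open>Weight distribution of the dual code\<close>

definition weight :: "bit ^ 'n \<Rightarrow> nat" where
  "weight c = card {i. c $ i = 1}"

lemma weight_vec_of: "length xs = 23 \<Longrightarrow> weight (vec_of xs) = count_list xs True"
proof -
  assume xs: "length xs = 23"
  have "{i. vec_of xs $ i = 1} = of_nat ` {k. k < 23 \<and> xs ! k}"
  proof (intro set_eqI iffI)
    fix i :: 23 assume "i \<in> {i. vec_of xs $ i = 1}"
    then have "xs ! index_of i" by (simp add: vec_of_def)
    then show "i \<in> of_nat ` {k. k < 23 \<and> xs ! k}"
      using index_of_less[of i] of_nat_index_of[of i] by (intro image_eqI[of _ _ "index_of i"]) auto
  qed (auto simp: vec_of_def index_of_of_nat)
  moreover have "inj_on (of_nat :: nat \<Rightarrow> 23) {k. k < 23 \<and> xs ! k}"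
    using bij_betw_of_nat_23 by (auto simp: bij_betw_def inj_on_def)
  ultimately have "weight (vec_of xs) = card {k. k < 23 \<and> xs ! k}"
    by (simp add: weight_def card_image)
  also have "\<dots> = length (filter (\<lambda>b. b) xs)"
    using xs by (simp add: length_filter_conv_card)
  also have "\<dots> = count_list xs True"
    by (induction xs) auto
  finally show ?thesis .
qed

lemma card_dual_golay: "card (dual_code golay_code) = 2048"
proof -
  have "card (dual_code golay_code) = card {bs :: bool list. length bs = 11}"
    using bij_betw_same_card[OF bij_betw_encode] by simp
  then show ?thesis
    using card_lists_length_eq[of "UNIV :: bool set" 11] by simp
qed

lemma card_dual_golay_weight:
  "card {c \<in> dual_code golay_code. weight c = w} = weight_count w (replicate 23 False) golay_rows"
proof -
  have w: "weight (encode bs) = count_list (combine (replicate 23 False) bs golay_rows) True" for bs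
    by (rule weight_vec_of) (simp add: length_combine length_golay_rows)
  have "bij_betw encode {bs \<in> {bs. length bs = 11}. weight (encode bs) = w}
      {c \<in> dual_code golay_code. weight c = w}"
    by (rule bij_betw_Collect[OF bij_betw_encode]) simp
  then have "card {c \<in> dual_code golay_code. weight c = w}
      = card {bs \<in> {bs. length bs = 11}. weight (encode bs) = w}"
    by (rule bij_betw_same_card[symmetric])
  then show ?thesis
    by (simp add: weight_count_eq_card length_golay_rows w)
qed

lemma weight_counts:
  "weight_count 8 (replicate 23 False) golay_rows = 506"
  "weight_count 12 (replicate 23 False) golay_rows = 1288"
  "weight_count 16 (replicate 23 False) golay_rows = 253"
  by code_simp+

text \<open>Pure counting: 1 + 506 + 1288 + 253 = 2048, so the zero word and the words of weights 8,
  12, 16 exhaust the code.\<close>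

lemma dual_golay_weight_cases:
  assumes "c \<in> dual_code golay_code" "c \<noteq> 0"
  shows "weight c \<in> {8, 12, 16}"
proof -
  let ?D = "dual_code golay_code"
  let ?W = "\<lambda>w. {c \<in> ?D. weight c = w}"
  have fin: "finite ?D" using card_dual_golay card.infinite by fastforce
  have W: "card (?W 8) = 506" "card (?W 12) = 1288" "card (?W 16) = 253"
    by (simp_all only: card_dual_golay_weight weight_counts)
  have w0: "weight (0 :: bit ^ 23) = 0" by (simp add: weight_def)
  let ?A = "insert 0 (?W 8 \<union> ?W 12 \<union> ?W 16)"
  have "card (?W 8 \<union> ?W 12 \<union> ?W 16) = 2047"
    using fin W by (subst card_Un_disjoint; (subst card_Un_disjoint)?) auto
  then have "card ?A = 2048"
    using fin w0 by (subst card_insert_disjoint) auto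
  moreover have "?A \<subseteq> ?D" by (auto simp: dual_code_def)
  ultimately have "?A = ?D"
    using fin card_dual_golay by (intro card_subset_eq) auto
  with assms show ?thesis by blast
qed

section \<open>Hermite interpolation of absolutely monotone functions\<close>

text \<open>One zero is taken strictly between each pair of consecutive zeros. That the new zeros
  avoid \<open>Z\<close> matters later: a double zero of \<open>g\<close> can then be added to them
  as a further zero of \<open>g'\<close>.\<close>

lemma rolle_zeros:
  fixes g :: "real \<Rightarrow> real"
  assumes Z: "finite Z" "Z \<subseteq> {l..u}" "\<And>z. z \<in> Z \<Longrightarrow> g z = 0"
    and cont: "continuous_on {l..u} g"
    and der: "\<And>t. t \<in> {l<..<u} \<Longrightarrow> (g has_real_derivative g' t) (at t)"
  obtains W where "finite W" "card W = card Z - 1" "W \<subseteq> {l<..<u}" "W \<inter> Z = {}"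
    "\<And>w. w \<in> W \<Longrightarrow> g' w = 0"
proof (cases "Z = {}")
  case True
  then show ?thesis by (intro that[of "{}"]) auto
next
  case False
  define next' where "next' z = Min {y \<in> Z. z < y}" for z
  let ?Z = "Z - {Max Z}"
  have nx: "next' z \<in> Z \<and> z < next' z \<and> (\<forall>y\<in>Z. z < y \<longrightarrow> next' z \<le> y)" if "z \<in> ?Z" for z
  proof -
    have "Max Z \<in> {y \<in> Z. z < y}"
      using that Z(1) False by (auto simp: order.strict_iff_order)
    then have "next' z \<in> {y \<in> Z. z < y}"
      unfolding next'_def using Z(1) by (intro Min_in) auto
    then show ?thesis using Z(1) by (auto simp: next'_def)
  qed
  have "\<exists>x. z < x \<and> x < next' z \<and> g' x = 0" if z: "z \<in> ?Z" for z
  proof -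
    have lu: "l \<le> z" "next' z \<le> u" using z nx[OF z] Z(2) by auto
    have "\<exists>x>z. x < next' z \<and> (\<lambda>v. g' x * v) = (\<lambda>v. 0)"
    proof (rule Rolle_deriv)
      show "z < next' z" "g z = g (next' z)" using z nx[OF z] Z(3) by auto
      show "continuous_on {z..next' z} g"
        using lu by (intro continuous_on_subset[OF cont]) auto
      show "(g has_derivative (\<lambda>v. g' x * v)) (at x)" if "z < x" "x < next' z" for x
        using der[of x] that lu by (auto simp: has_field_derivative_def)
    qed
    then show ?thesis by (metis mult.right_neutral)
  qed
  then obtain r where r: "\<And>z. z \<in> ?Z \<Longrightarrow> z < r z \<and> r z < next' z \<and> g' (r z) = 0"
    by metis
  have mono: "r x < r y" if "x \<in> ?Z" "y \<in> ?Z" "x < y" for x y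
    using r[OF that(1)] r[OF that(2)] nx[OF that(1)] that by force
  have inj: "inj_on r ?Z"
    by (rule linorder_inj_onI') (use mono in force)
  show thesis
  proof (rule that[of "r ` ?Z"])
    show "card (r ` ?Z) = card Z - 1"
      using inj Z(1) False by (simp add: card_image)
    show "r ` ?Z \<subseteq> {l<..<u}"
    proof (rule image_subsetI)
      fix z assume z: "z \<in> ?Z"
      show "r z \<in> {l<..<u}" using r[OF z] nx[OF z] Z(2) z by force
    qed
    show "r ` ?Z \<inter> Z = {}"
    proof -
      have "r z \<notin> Z" if z: "z \<in> ?Z" for z
        using r[OF z] nx[OF z] by force
      then show ?thesis by blast
    qed
  qed (use Z(1) r in auto)
qed

text \<open>\<open>G j\<close> stands for the \<open>j\<close>-th derivative. After one step all
  zeros lie in the open interval, where every \<open>G j\<close> is differentiable; this is why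
  continuity up to the ends is asked of \<open>G 0\<close> alone.\<close>

lemma iterated_rolle:
  fixes G :: "nat \<Rightarrow> real \<Rightarrow> real"
  assumes "finite Z" "card Z = Suc m" "0 < m" "Z \<subseteq> {l..u}" "\<And>z. z \<in> Z \<Longrightarrow> G 0 z = 0"
    and "continuous_on {l..u} (G 0)"
    and "\<And>j t. t \<in> {l<..<u} \<Longrightarrow> (G j has_real_derivative G (Suc j) t) (at t)"
  shows "\<exists>\<xi>\<in>{l<..<u}. G m \<xi> = 0"
  using assms
proof (induction m arbitrary: G Z l u)
  case (Suc m)
  obtain W where W: "finite W" "card W = card Z - 1" "W \<subseteq> {l<..<u}" "\<And>w. w \<in> W \<Longrightarrow> G (Suc 0) w = 0"
    by (rule rolle_zeros[OF Suc.prems(1,4,5,6), of "G (Suc 0)"]) (use Suc.prems(7) in auto)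
  with Suc.prems(2) have card: "card W = Suc m" by simp
  then have "W \<noteq> {}" by auto
  show ?case
  \<comment> \<open>Here \<open>W\<close> is a single point: it already is the required zero, while
    \<open>{Min W<..<Max W}\<close> is empty.\<close>
  proof (cases "m = 0")
    case True
    with W \<open>W \<noteq> {}\<close> show ?thesis by auto
  next
    case False
    have sub: "{Min W..Max W} \<subseteq> {l<..<u}"
    proof -
      have "Min W \<in> {l<..<u}" "Max W \<in> {l<..<u}" using W(1,3) \<open>W \<noteq> {}\<close> Min_in Max_in by blast+
      then show ?thesis by auto
    qed
    have "\<exists>\<xi>\<in>{Min W<..<Max W}. (\<lambda>j. G (Suc j)) m \<xi> = 0"
    proof (rule Suc.IH[OF W(1) card])
      show "continuous_on {Min W..Max W} (G (Suc 0))"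
        using sub Suc.prems(7) by (intro continuous_at_imp_continuous_on ballI DERIV_isCont) blast
      show "(G (Suc j) has_real_derivative G (Suc (Suc j)) t) (at t)" if "t \<in> {Min W<..<Max W}" for j t
        using that by (intro Suc.prems(7) subsetD[OF sub]) auto
    qed (use W(1,4) False in auto)
    with sub show ?thesis by force
  qed
qed simp

text \<open>A double zero counts twice: Rolle yields \<open>m - 1\<close> zeros of the derivative
  off \<open>Z\<close>, and \<open>d\<close> is one more, so the simple iteration can continue from
  \<open>G 1\<close>.\<close>

lemma iterated_rolle_double_node:
  fixes G :: "nat \<Rightarrow> real \<Rightarrow> real"
  assumes Z: "finite Z" "card Z = m" "Z \<subseteq> {l..u}" "\<And>z. z \<in> Z \<Longrightarrow> G 0 z = 0"
    and d: "d \<in> Z" "d \<in> {l<..<u}" "G 1 d = 0"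
    and cont: "continuous_on {l..u} (G 0)"
    and der: "\<And>j t. t \<in> {l<..<u} \<Longrightarrow> (G j has_real_derivative G (Suc j) t) (at t)"
  shows "\<exists>\<xi>\<in>{l<..<u}. G m \<xi> = 0"
proof -
  obtain W where W: "finite W" "card W = card Z - 1" "W \<subseteq> {l<..<u}" "W \<inter> Z = {}"
      "\<And>w. w \<in> W \<Longrightarrow> G (Suc 0) w = 0"
    by (rule rolle_zeros[OF Z(1,3,4) cont, of "G (Suc 0)"]) (use der in auto)
  have m: "0 < m" using Z(1,2) d(1) by (auto simp: card_gt_0_iff)
  have card: "card (insert d W) = Suc (m - 1)"
    using W(1,2,4) d(1) Z(2) m by (subst card_insert_disjoint) auto
  show ?thesis
  proof (cases "m = 1")
    case True
    with d show ?thesis by auto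
  next
    case False
    let ?W = "insert d W"
    have sub: "{Min ?W..Max ?W} \<subseteq> {l<..<u}"
    proof -
      have "Min ?W \<in> ?W" "Max ?W \<in> ?W" using W(1) by (simp_all only: Min_in Max_in finite_insert insert_not_empty not_False_eq_True)
      moreover have "?W \<subseteq> {l<..<u}" using W(3) d(2) by blast
      ultimately have "Min ?W \<in> {l<..<u}" "Max ?W \<in> {l<..<u}" by blast+
      then show ?thesis by auto
    qed
    have "\<exists>\<xi>\<in>{Min ?W<..<Max ?W}. (\<lambda>j. G (Suc j)) (m - 1) \<xi> = 0"
    proof (rule iterated_rolle[OF _ card])
      show "continuous_on {Min ?W..Max ?W} (G (Suc 0))"
        using sub der by (intro continuous_at_imp_continuous_on ballI DERIV_isCont) blast
      show "(G (Suc j) has_real_derivative G (Suc (Suc j)) t) (at t)" if "t \<in> {Min ?W<..<Max ?W}" for j t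
        using that by (intro der subsetD[OF sub]) auto
      show "?W \<subseteq> {Min ?W..Max ?W}"
        using W(1) by (auto simp del: Min_insert Max_insert)
    qed (use W(1,5) d(3) False m in auto)
    with sub m show ?thesis by force
  qed
qed

lemma poly_higher_pderiv_degree:
  fixes p :: "real poly"
  assumes "degree p \<le> m"
  shows "poly ((pderiv ^^ m) p) x = fact m * coeff p m"
proof -
  have "coeff ((pderiv ^^ m) p) n = 0" if "n > 0" for n
    using assms that by (simp add: coeff_higher_pderiv coeff_eq_0)
  then have "(pderiv ^^ m) p = [:coeff ((pderiv ^^ m) p) 0:]"
    by (intro poly_eqI) (simp add: coeff_pCons split: nat.split)
  also have "poly \<dots> x = fact m * coeff p m"
    by (simp add: coeff_higher_pderiv pochhammer_fact)
  finally show ?thesis .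
qed

lemma absolutely_monotone_DERIV:
  assumes "absolutely_monotone h" "t \<in> {-1<..<1}"
  shows "((deriv ^^ j) h has_real_derivative (deriv ^^ Suc j) h t) (at t)"
  using assms DERIV_deriv_iff_real_differentiable
  unfolding absolutely_monotone_def by auto

text \<open>The mean value form of divided differences: \<open>h - p\<close> has
  \<open>m + 1\<close> zeros with multiplicity, so its derivative of order \<open>m\<close> vanishes
  somewhere. It serves both for the signs of the Newton coefficients and for the error term.\<close>

lemma hermite_interpolation:
  assumes h: "absolutely_monotone h"
    and Z: "finite Z" "Z \<subseteq> {-1..<1}" "\<And>z. z \<in> Z \<Longrightarrow> h z = poly p z"
    and p: "degree p \<le> m" "0 < m"
    and nodes: "card Z = Suc m \<or>
      card Z = m \<and> d \<in> Z \<and> -1 < d \<and> deriv h d = poly (pderiv p) d"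
  shows "\<exists>\<xi>\<in>{-1<..<1}. (deriv ^^ m) h \<xi> = fact m * coeff p m"
proof -
  define G where "G j t = (deriv ^^ j) h t - poly ((pderiv ^^ j) p) t" for j t
  \<comment> \<open>\<open>h\<close> may be unbounded near 1, so the interval ends halfway between
    the largest node and 1.\<close>
  define u where "u = (Max Z + 1) / 2"
  have ne: "Z \<noteq> {}" using nodes p(2) by auto
  then have "Max Z \<in> {-1..<1}" using Z(1,2) Max_in by blast
  then have u: "Max Z < u" "u < 1" "-1 < u" by (auto simp: u_def)
  have "z \<le> u" if "z \<in> Z" for z using Max_ge[OF Z(1) that] u(1) by simp
  then have Zu: "Z \<subseteq> {-1..u}" using Z(2) by auto
  have zeros: "G 0 z = 0" if "z \<in> Z" for z using Z(3) that by (simp add: G_def)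
  have cont: "continuous_on {-1..u} (G 0)"
    unfolding G_def using h u
    by (auto intro!: continuous_intros continuous_on_subset[of "{-1..<1}" h]
      simp: absolutely_monotone_def potential_def)
  have der: "(G j has_real_derivative G (Suc j) t) (at t)" if "t \<in> {-1<..<u}" for j t
  proof -
    have "(poly ((pderiv ^^ j) p) has_real_derivative poly ((pderiv ^^ Suc j) p) t) (at t)"
      using poly_DERIV by simp
    moreover have "((deriv ^^ j) h has_real_derivative (deriv ^^ Suc j) h t) (at t)"
      using absolutely_monotone_DERIV[OF h] that u by simp
    ultimately show ?thesis unfolding G_def by (rule DERIV_diff[rotated])
  qed
  have "\<exists>\<xi>\<in>{-1<..<u}. G m \<xi> = 0"
    using nodes
  proof (elim disjE conjE)
    assume "card Z = Suc m"
    then show ?thesis by (rule iterated_rolle[OF Z(1) _ p(2) Zu zeros cont der])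
  next
    assume "card Z = m" "d \<in> Z" "-1 < d" "deriv h d = poly (pderiv p) d"
    moreover from \<open>d \<in> Z\<close> have "d < u" using Max_ge[OF Z(1) \<open>d \<in> Z\<close>] u(1) by linarith
    ultimately show ?thesis
      by (intro iterated_rolle_double_node[OF Z(1) _ Zu zeros _ _ _ cont der, where d = d])
        (auto simp: G_def)
  qed
  with u p(1) show ?thesis by (force simp: G_def poly_higher_pderiv_degree)
qed

text \<open>The derivative of order \<open>j\<close> is strictly increasing and already nonnegative
  further left, at the midpoint of -1 and \<open>t\<close>. This passes positivity from order 4 down
  to orders 3, 2 and 1.\<close>

lemma absolutely_monotone_strict:
  assumes h: "absolutely_monotone h"
    and pos: "\<And>t. t \<in> {-1<..<1} \<Longrightarrow> (deriv ^^ Suc j) h t > 0"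
    and j: "1 \<le> j" and t: "t \<in> {-1<..<1}"
  shows "(deriv ^^ j) h t > 0"
proof -
  define s where "s = (t - 1) / 2"
  have s: "-1 < s" "s < t" using t by (auto simp: s_def)
  have "(deriv ^^ j) h s < (deriv ^^ j) h t"
  proof (rule DERIV_pos_imp_increasing[OF s(2)])
    fix x assume "s \<le> x" "x \<le> t"
    then have "x \<in> {-1<..<1}" using s t by auto
    then show "\<exists>y. ((deriv ^^ j) h has_real_derivative y) (at x) \<and> 0 < y"
      using absolutely_monotone_DERIV[OF h] pos by blast
  qed
  moreover have "(deriv ^^ j) h s \<ge> 0"
    using h j s t by (auto simp: absolutely_monotone_def)
  ultimately show ?thesis by linarith
qed

section \<open>The cubic minorant\<close>

definition newton_cubic :: "real \<Rightarrow> real \<Rightarrow> real \<Rightarrow> real \<Rightarrow> real \<Rightarrow> real \<Rightarrow> real \<Rightarrow> real \<Rightarrow> real" where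
  "newton_cubic a b c A\<^sub>0 A\<^sub>1 A\<^sub>2 A\<^sub>3 t =
     A\<^sub>0 + A\<^sub>1 * (t - a) + A\<^sub>2 * ((t - a) * (t - b)) + A\<^sub>3 * ((t - a) * (t - b) * (t - c))"

text \<open>The double node \<open>d\<close> is the inner product at which the excluded interval does not end, so the
  error factor is nonnegative outside that interval.\<close>

lemma hermite_minorant:
  fixes a b c d :: real
  assumes h: "absolutely_monotone h"
    and nodes: "-1 < a" "a < b" "b < c" "c < 1" "d = a \<or> d = c"
  obtains A\<^sub>0 A\<^sub>1 A\<^sub>2 A\<^sub>3 where
    "\<And>t. t \<in> {a, b, c} \<Longrightarrow> newton_cubic a b c A\<^sub>0 A\<^sub>1 A\<^sub>2 A\<^sub>3 t = h t"
    "0 \<le> A\<^sub>1" "0 \<le> A\<^sub>2" "0 \<le> A\<^sub>3"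
    "\<And>t. t \<in> {-1..<1} \<Longrightarrow> (t - a) * (t - b) * (t - c) * (t - d) \<ge> 0 \<Longrightarrow>
       newton_cubic a b c A\<^sub>0 A\<^sub>1 A\<^sub>2 A\<^sub>3 t \<le> h t"
    "(\<And>t. t \<in> {-1<..<1} \<Longrightarrow> (deriv ^^ 4) h t > 0) \<Longrightarrow>
       0 < A\<^sub>1 \<and> 0 < A\<^sub>2 \<and> 0 < A\<^sub>3 \<and>
       (\<forall>t\<in>{-1..<1} - {a, b, c}. (t - a) * (t - b) * (t - c) * (t - d) \<ge> 0 \<longrightarrow>
          newton_cubic a b c A\<^sub>0 A\<^sub>1 A\<^sub>2 A\<^sub>3 t < h t)"
proof -
  \<comment> \<open>Successive divided differences of \<open>h\<close> at \<open>a\<close>, then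
    \<open>a\<close>, \<open>b\<close>, then \<open>a\<close>, \<open>b\<close>, \<open>c\<close>;
    each is the leading coefficient of the interpolating polynomial on these nodes.\<close>
  define A\<^sub>0 where "A\<^sub>0 = h a"
  define A\<^sub>1 where "A\<^sub>1 = (h b - A\<^sub>0) / (b - a)"
  define A\<^sub>2 where "A\<^sub>2 = (h c - A\<^sub>0 - A\<^sub>1 * (c - a)) / ((c - a) * (c - b))"
  define P\<^sub>1 where "P\<^sub>1 = [:-a, 1:]"
  define P\<^sub>2 where "P\<^sub>2 = [:a * b, - (a + b), 1:]"
  define P\<^sub>3 where "P\<^sub>3 = [:- a * b * c, a * b + a * c + b * c, - (a + b + c), 1:]"
  define q\<^sub>1 where "q\<^sub>1 = [:A\<^sub>0:] + smult A\<^sub>1 P\<^sub>1"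
  define q\<^sub>2 where "q\<^sub>2 = q\<^sub>1 + smult A\<^sub>2 P\<^sub>2"
  \<comment> \<open>A multiple of \<open>P\<^sub>3\<close> leaves the values at the nodes unchanged;
    this multiple also matches the derivative at \<open>d\<close>, making \<open>d\<close> a double
    node.\<close>
  define A\<^sub>3 where "A\<^sub>3 = (deriv h d - poly (pderiv q\<^sub>2) d) / poly (pderiv P\<^sub>3) d"
  define q\<^sub>3 where "q\<^sub>3 = q\<^sub>2 + smult A\<^sub>3 P\<^sub>3"
  note P_defs = P\<^sub>1_def P\<^sub>2_def P\<^sub>3_def
  have P: "poly P\<^sub>1 t = t - a" "poly P\<^sub>2 t = (t - a) * (t - b)"
    "poly P\<^sub>3 t = (t - a) * (t - b) * (t - c)" for t
    by (simp_all add: P_defs algebra_simps)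
  have q: "poly q\<^sub>1 t = A\<^sub>0 + A\<^sub>1 * (t - a)"
    "poly q\<^sub>2 t = A\<^sub>0 + A\<^sub>1 * (t - a) + A\<^sub>2 * ((t - a) * (t - b))"
    "poly q\<^sub>3 t = newton_cubic a b c A\<^sub>0 A\<^sub>1 A\<^sub>2 A\<^sub>3 t" for t
    by (simp_all add: q\<^sub>1_def q\<^sub>2_def q\<^sub>3_def newton_cubic_def P)
  have ha: "h a = A\<^sub>0" by (simp add: A\<^sub>0_def)
  have hb: "h b = A\<^sub>0 + A\<^sub>1 * (b - a)" using nodes by (simp add: A\<^sub>1_def)
  have hc: "h c = A\<^sub>0 + A\<^sub>1 * (c - a) + A\<^sub>2 * ((c - a) * (c - b))" using nodes by (simp add: A\<^sub>2_def)
  have d: "-1 < d" "d \<in> {a, b, c}" using nodes by auto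
  have "poly (pderiv P\<^sub>3) a = (a - b) * (a - c)" "poly (pderiv P\<^sub>3) c = (c - a) * (c - b)"
    by (simp_all add: P_defs pderiv_pCons algebra_simps)
  then have "poly (pderiv P\<^sub>3) d \<noteq> 0" using nodes by auto
  then have hd: "deriv h d = poly (pderiv q\<^sub>3) d"
    by (simp add: q\<^sub>3_def A\<^sub>3_def pderiv_add pderiv_smult)
  have eq: "h z = poly q\<^sub>3 z" if "z \<in> {a, b, c}" for z
    using that ha hb hc by (auto simp: q newton_cubic_def)
  have deg: "degree q\<^sub>1 \<le> 1" "degree q\<^sub>2 \<le> 2" "degree q\<^sub>3 \<le> 3"
    by (rule degree_le, simp add: q\<^sub>3_def q\<^sub>2_def q\<^sub>1_def P_defs coeff_pCons split: nat.split)+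
  have card: "card {a, b} = 2" "card {a, b, c} = 3"
    using nodes by auto
  have sub: "{a, b, c} \<subseteq> {-1..<1}" using nodes by auto
  have \<xi>1: "\<exists>\<xi>\<in>{-1<..<1}. (deriv ^^ 1) h \<xi> = fact 1 * coeff q\<^sub>1 1"
  proof (rule hermite_interpolation[OF h])
    show "h z = poly q\<^sub>1 z" if "z \<in> {a, b}" for z using that ha hb by (auto simp: q)
    show "{a, b} \<subseteq> {-1..<1}" using sub by blast
    show "card {a, b} = Suc 1 \<or> card {a, b} = 1 \<and> a \<in> {a, b} \<and> -1 < a \<and> deriv h a = poly (pderiv q\<^sub>1) a"
      using card by simp
  qed (use deg in simp_all)
  have \<xi>2: "\<exists>\<xi>\<in>{-1<..<1}. (deriv ^^ 2) h \<xi> = fact 2 * coeff q\<^sub>2 2"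
  proof (rule hermite_interpolation[OF h])
    show "h z = poly q\<^sub>2 z" if "z \<in> {a, b, c}" for z using that ha hb hc by (auto simp: q)
    show "card {a, b, c} = Suc 2 \<or> card {a, b, c} = 2 \<and> a \<in> {a, b, c} \<and> -1 < a \<and> deriv h a = poly (pderiv q\<^sub>2) a"
      using card by simp
  qed (use deg sub in simp_all)
  have \<xi>3: "\<exists>\<xi>\<in>{-1<..<1}. (deriv ^^ 3) h \<xi> = fact 3 * coeff q\<^sub>3 3"
    by (rule hermite_interpolation[OF h _ sub eq, where d = d]) (use deg card d hd in simp_all)
  have coeffs: "coeff q\<^sub>1 1 = A\<^sub>1" "coeff q\<^sub>2 2 = A\<^sub>2" "coeff q\<^sub>3 3 = A\<^sub>3"
    by (simp_all add: q\<^sub>3_def q\<^sub>2_def q\<^sub>1_def P_defs numeral_eq_Suc)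
  have nonneg: "(deriv ^^ j) h \<xi> \<ge> 0" if "1 \<le> j" "\<xi> \<in> {-1<..<1}" for j \<xi>
    using h that unfolding absolutely_monotone_def by blast
  have err: "\<exists>\<xi>\<in>{-1<..<1}. h t - newton_cubic a b c A\<^sub>0 A\<^sub>1 A\<^sub>2 A\<^sub>3 t
      = (deriv ^^ 4) h \<xi> / 24 * ((t - a) * (t - b) * (t - c) * (t - d))"
    if t: "t \<in> {-1..<1} - {a, b, c}" for t
  proof -
    \<comment> \<open>The usual device for the interpolation error: \<open>K\<close> makes the
      quartic \<open>q\<^sub>4\<close> meet \<open>h\<close> at \<open>t\<close> as well. With
      \<open>d\<close> counted twice there are five nodes, so the leading coefficient
      \<open>K\<close> is a fourth derivative divided by 24.\<close>
    define K where "K = (h t - poly q\<^sub>3 t) / ((t - a) * (t - b) * (t - c) * (t - d))"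
    define q\<^sub>4 where "q\<^sub>4 = q\<^sub>3 + smult K (P\<^sub>3 * [:-d, 1:])"
    have q4: "poly q\<^sub>4 s = poly q\<^sub>3 s + K * ((s - a) * (s - b) * (s - c) * (s - d))" for s
      by (simp add: q\<^sub>4_def P algebra_simps)
    have ne: "(t - a) * (t - b) * (t - c) * (t - d) \<noteq> 0"
      using t nodes by auto
    have q4t: "poly q\<^sub>4 t = h t" using ne by (simp add: q4 K_def)
    have "poly P\<^sub>3 d = 0" using d by (auto simp: P)
    then have hd4: "poly (pderiv q\<^sub>4) d = poly (pderiv q\<^sub>3) d"
      by (simp add: q\<^sub>4_def pderiv_add pderiv_smult pderiv_diff pderiv_pCons)
    have deg4: "degree q\<^sub>4 \<le> 4"
      by (rule degree_le) (simp add: q\<^sub>4_def q\<^sub>3_def q\<^sub>2_def q\<^sub>1_def P_defs coeff_pCons split: nat.split)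
    have \<xi>4: "\<exists>\<xi>\<in>{-1<..<1}. (deriv ^^ 4) h \<xi> = fact 4 * coeff q\<^sub>4 4"
    proof (rule hermite_interpolation[OF h])
      show "h z = poly q\<^sub>4 z" if "z \<in> insert t {a, b, c}" for z
      proof (cases "z = t")
        case False
        with that have "z \<in> {a, b, c}" by blast
        then show ?thesis using eq[of z] by (auto simp: q4)
      qed (simp add: q4t)
      show "insert t {a, b, c} \<subseteq> {-1..<1}" using t sub by blast
      have "card (insert t {a, b, c}) = 4" using t card(2) by (subst card_insert_disjoint) auto
      then show "card (insert t {a, b, c}) = Suc 4 \<or> card (insert t {a, b, c}) = 4 \<and> d \<in> insert t {a, b, c} \<and> -1 < d \<and> deriv h d = poly (pderiv q\<^sub>4) d"
        using d hd hd4 by simp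
    qed (use deg4 in simp_all)
    have "coeff q\<^sub>4 4 = K"
      by (simp add: q\<^sub>4_def q\<^sub>3_def q\<^sub>2_def q\<^sub>1_def P_defs numeral_eq_Suc)
    with \<xi>4 obtain \<xi> where "\<xi> \<in> {-1<..<1}" "K = (deriv ^^ 4) h \<xi> / 24"
      by (auto simp: fact_numeral)
    moreover have "h t - newton_cubic a b c A\<^sub>0 A\<^sub>1 A\<^sub>2 A\<^sub>3 t = K * ((t - a) * (t - b) * (t - c) * (t - d))"
      using q4t q4[of t] q(3) by simp
    ultimately show ?thesis by blast
  qed
  show thesis
  proof (rule that)
    show "newton_cubic a b c A\<^sub>0 A\<^sub>1 A\<^sub>2 A\<^sub>3 t = h t" if "t \<in> {a, b, c}" for t
      using eq[OF that] q(3) by simp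
    show "0 \<le> A\<^sub>1" using \<xi>1 nonneg[of 1] coeffs by fastforce
    show "0 \<le> A\<^sub>2" using \<xi>2 nonneg[of 2] coeffs by fastforce
    show "0 \<le> A\<^sub>3" using \<xi>3 nonneg[of 3] coeffs by (fastforce simp: fact_numeral)
    show "newton_cubic a b c A\<^sub>0 A\<^sub>1 A\<^sub>2 A\<^sub>3 t \<le> h t"
      if t: "t \<in> {-1..<1}" and w: "(t - a) * (t - b) * (t - c) * (t - d) \<ge> 0" for t
    proof (cases "t \<in> {a, b, c}")
      case True
      then show ?thesis using eq q(3) by simp
    next
      case False
      then obtain \<xi> where "\<xi> \<in> {-1<..<1}" "h t - newton_cubic a b c A\<^sub>0 A\<^sub>1 A\<^sub>2 A\<^sub>3 t
          = (deriv ^^ 4) h \<xi> / 24 * ((t - a) * (t - b) * (t - c) * (t - d))"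
        using err[of t] t by blast
      then show ?thesis using nonneg[of 4 \<xi>] w by (smt (verit) divide_nonneg_pos mult_nonneg_nonneg one_le_numeral)
    qed
  next
    assume pos4: "\<And>t. t \<in> {-1<..<1} \<Longrightarrow> (deriv ^^ 4) h t > 0"
    have pos3: "(deriv ^^ 3) h t > 0" if "t \<in> {-1<..<1}" for t
      using absolutely_monotone_strict[OF h, of 3] pos4 that by (simp add: numeral_eq_Suc)
    have pos2: "(deriv ^^ 2) h t > 0" if "t \<in> {-1<..<1}" for t
      using absolutely_monotone_strict[OF h, of 2] pos3 that by (simp add: numeral_eq_Suc)
    have pos1: "(deriv ^^ 1) h t > 0" if "t \<in> {-1<..<1}" for t
      using absolutely_monotone_strict[OF h, of 1] pos2 that by (simp add: numeral_eq_Suc)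
    have "0 < A\<^sub>1" using \<xi>1 pos1 coeffs by fastforce
    moreover have "0 < A\<^sub>2" using \<xi>2 pos2 coeffs by fastforce
    moreover have "0 < A\<^sub>3" using \<xi>3 pos3 coeffs by (fastforce simp: fact_numeral)
    moreover have "newton_cubic a b c A\<^sub>0 A\<^sub>1 A\<^sub>2 A\<^sub>3 t < h t"
      if t: "t \<in> {-1..<1} - {a, b, c}" and w: "(t - a) * (t - b) * (t - c) * (t - d) \<ge> 0" for t
    proof -
      obtain \<xi> where \<xi>: "\<xi> \<in> {-1<..<1}" "h t - newton_cubic a b c A\<^sub>0 A\<^sub>1 A\<^sub>2 A\<^sub>3 t
          = (deriv ^^ 4) h \<xi> / 24 * ((t - a) * (t - b) * (t - c) * (t - d))"
        using err[OF t] by blast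
      moreover have "(t - a) * (t - b) * (t - c) * (t - d) > 0"
        using t nodes w by (auto simp: order.strict_iff_order)
      ultimately show ?thesis using pos4[OF \<xi>(1)]
        by (smt (verit) divide_pos_pos mult_pos_pos)
    qed
    ultimately show "0 < A\<^sub>1 \<and> 0 < A\<^sub>2 \<and> 0 < A\<^sub>3 \<and>
       (\<forall>t\<in>{-1..<1} - {a, b, c}. (t - a) * (t - b) * (t - c) * (t - d) \<ge> 0 \<longrightarrow>
          newton_cubic a b c A\<^sub>0 A\<^sub>1 A\<^sub>2 A\<^sub>3 t < h t)"
      by blast
  qed
qed

section \<open>Positive definite kernels on the sphere\<close>

text \<open>The functions \<open>\<phi> m\<close> act as a feature map: the double sum is
  nonnegative, and it vanishes only if every feature sums to 0 over \<open>C\<close>.\<close>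

lemma sum_kernel:
  fixes \<phi> :: "'m \<Rightarrow> 'a \<Rightarrow> real"
  assumes "finite M" "\<And>x y. x \<in> C \<Longrightarrow> y \<in> C \<Longrightarrow> K x y = (\<Sum>m\<in>M. \<phi> m x * \<phi> m y)"
  shows "(\<Sum>x\<in>C. \<Sum>y\<in>C. K x y) = (\<Sum>m\<in>M. (\<Sum>x\<in>C. \<phi> m x)\<^sup>2)"
proof -
  have "(\<Sum>x\<in>C. \<Sum>y\<in>C. K x y) = (\<Sum>x\<in>C. \<Sum>y\<in>C. \<Sum>m\<in>M. \<phi> m x * \<phi> m y)"
    by (intro sum.cong) (simp_all add: assms(2))
  also have "\<dots> = (\<Sum>m\<in>M. \<Sum>x\<in>C. \<Sum>y\<in>C. \<phi> m x * \<phi> m y)"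
    by (simp only: sum.swap[of _ M])
  also have "\<dots> = (\<Sum>m\<in>M. (\<Sum>x\<in>C. \<phi> m x)\<^sup>2)"
    by (simp add: power2_eq_square sum_product)
  finally show ?thesis .
qed

text \<open>Unlike in \<open>energy\<close>, the diagonal is included; the sum-of-squares identities
  concern the full double sum.\<close>

definition power_sum :: "nat \<Rightarrow> (real ^ 'n) set \<Rightarrow> real" where
  "power_sum k C = (\<Sum>x\<in>C. \<Sum>y\<in>C. (x \<bullet> y) ^ k)"

lemma power_sum_0: "power_sum 0 C = (real (card C))\<^sup>2"
  by (simp add: power_sum_def power2_eq_square)

definition delta :: "'n \<Rightarrow> 'n \<Rightarrow> real" where
  "delta i j = (if i = j then 1 else 0)"

lemma sum_delta:
  fixes f :: "'n::finite \<Rightarrow> real"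
  shows "(\<Sum>j\<in>UNIV. delta i j * f j) = f i" "(\<Sum>j\<in>UNIV. f j * delta i j) = f i"
    "(\<Sum>j\<in>UNIV. delta j i * f j) = f i" "(\<Sum>j\<in>UNIV. f j * delta j i) = f i"
  by (simp_all add: delta_def if_distrib[of "\<lambda>x. x * _"] if_distrib[of "\<lambda>x. _ * x"] cong: if_cong)

lemma unit_sum_squares:
  fixes x :: "real ^ 'n"
  assumes "x \<in> sphere 0 1"
  shows "(\<Sum>i\<in>UNIV. x $ i * x $ i) = 1"
  using assms by (simp add: norm_eq_1 inner_vec_def)

lemma power_sum_1: "power_sum 1 C = (\<Sum>i\<in>UNIV. (\<Sum>x\<in>C. x $ i)\<^sup>2)"
  unfolding power_sum_def
  by (rule sum_kernel) (simp_all add: inner_vec_def)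

text \<open>The left side is, up to scale, the Gegenbauer polynomial of degree 2; the features are
  the entries of the trace-free part of the matrix with entries
  \<open>x $ i * x $ j\<close>.\<close>

lemma kernel_2:
  fixes x y :: "real ^ 'n"
  assumes "x \<in> sphere 0 1" "y \<in> sphere 0 1"
  shows "(x \<bullet> y)\<^sup>2 - 1 / CARD('n) =
    (\<Sum>(i, j)\<in>UNIV. (x $ i * x $ j - delta i j / CARD('n)) * (y $ i * y $ j - delta i j / CARD('n)))"
proof -
  let ?n = "real CARD('n)"
  have "(x $ i * x $ j - delta i j / ?n) * (y $ i * y $ j - delta i j / ?n)
      = (x $ i * y $ i) * (x $ j * y $ j) - delta i j * (x $ i * x $ j) / ?n
        - delta i j * (y $ i * y $ j) / ?n + delta i j * 1 / ?n\<^sup>2" for i j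
    by (simp add: delta_def algebra_simps power2_eq_square)
  then have "(\<Sum>(i, j)\<in>UNIV. (x $ i * x $ j - delta i j / ?n) * (y $ i * y $ j - delta i j / ?n))
      = (\<Sum>i\<in>UNIV. \<Sum>j\<in>UNIV. (x $ i * y $ i) * (x $ j * y $ j))
        - (\<Sum>i\<in>UNIV. \<Sum>j\<in>UNIV. delta i j * (x $ i * x $ j)) / ?n
        - (\<Sum>i\<in>UNIV. \<Sum>j\<in>UNIV. delta i j * (y $ i * y $ j)) / ?n
        + (\<Sum>i\<in>UNIV. \<Sum>j\<in>(UNIV::'n set). delta i j * 1) / ?n\<^sup>2"
    by (simp add: UNIV_Times_UNIV[symmetric] sum.cartesian_product[symmetric] sum.distrib
        sum_subtractf sum_divide_distrib del: UNIV_Times_UNIV)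
  also have "(\<Sum>i\<in>UNIV. \<Sum>j\<in>UNIV. (x $ i * y $ i) * (x $ j * y $ j)) = (x \<bullet> y)\<^sup>2"
    by (simp add: inner_vec_def power2_eq_square sum_product)
  also have "(\<Sum>i\<in>UNIV. \<Sum>j\<in>UNIV. delta i j * (x $ i * x $ j)) = 1"
    using unit_sum_squares[OF assms(1)] by (simp add: sum_delta)
  also have "(\<Sum>i\<in>UNIV. \<Sum>j\<in>UNIV. delta i j * (y $ i * y $ j)) = 1"
    using unit_sum_squares[OF assms(2)] by (simp add: sum_delta)
  also have "(\<Sum>i\<in>UNIV. \<Sum>j\<in>(UNIV::'n set). delta i j * 1) = ?n"
    by (simp only: sum_delta) simp
  finally have "(\<Sum>(i, j)\<in>UNIV. (x $ i * x $ j - delta i j / ?n) * (y $ i * y $ j - delta i j / ?n))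
      = (x \<bullet> y)\<^sup>2 - 1 / ?n - 1 / ?n + ?n / ?n\<^sup>2" .
  moreover have "?n / ?n\<^sup>2 = 1 / ?n" by (simp add: power2_eq_square)
  ultimately show ?thesis by simp
qed

lemma power_sum_2:
  fixes C :: "(real ^ 'n) set"
  assumes "C \<subseteq> sphere 0 1"
  shows "power_sum 2 C - (real (card C))\<^sup>2 / CARD('n)
    = (\<Sum>(i, j)\<in>UNIV. (\<Sum>x\<in>C. x $ i * x $ j - delta i j / CARD('n))\<^sup>2)"
proof -
  have "(\<Sum>x\<in>C. \<Sum>y\<in>C. (x \<bullet> y)\<^sup>2 - 1 / CARD('n))
    = (\<Sum>m\<in>UNIV. (\<Sum>x\<in>C. (\<lambda>(i, j) x. x $ i * x $ j - delta i j / CARD('n)) m x)\<^sup>2)"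
    by (rule sum_kernel) (use assms in \<open>auto simp: kernel_2 case_prod_unfold subset_iff\<close>)
  then show ?thesis
    by (simp add: power_sum_def sum_subtractf power2_eq_square case_prod_unfold)
qed

text \<open>The trace-free part of the third tensor power of a unit vector.\<close>

definition harmonic3 :: "'n \<times> 'n \<times> 'n \<Rightarrow> real ^ 'n \<Rightarrow> real" where
  "harmonic3 = (\<lambda>(i, j, k) x. x $ i * x $ j * x $ k
     - (delta i j * x $ k + delta i k * x $ j + delta j k * x $ i) / (CARD('n) + 2))"

text \<open>Up to scale, the Gegenbauer polynomial of degree 3. With \<open>t\<close> the inner
  product and \<open>n\<close> the dimension, each of the two cross terms of the expanded product
  contributes \<open>- 3 * t / (n + 2)\<close> and the product of the two corrections contributes
  \<open>3 * t / (n + 2)\<close>, so one copy of the former survives.\<close>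

lemma kernel_3:
  fixes x y :: "real ^ 'n"
  assumes "x \<in> sphere 0 1" "y \<in> sphere 0 1"
  shows "(x \<bullet> y) ^ 3 - 3 / (CARD('n) + 2) * (x \<bullet> y) = (\<Sum>m\<in>UNIV. harmonic3 m x * harmonic3 m y)"
proof -
  let ?n = "real CARD('n)"
  define D where "D z i j k = delta i j * z $ k + delta i k * z $ j + delta j k * z $ i"
    for z :: "real ^ 'n" and i j k
  have DX: "(\<Sum>i\<in>UNIV. \<Sum>j\<in>UNIV. \<Sum>k\<in>UNIV. D z i j k * (w $ i * w $ j * w $ k)) = 3 * (z \<bullet> w)"
    if "w \<in> sphere 0 1" for z w :: "real ^ 'n"
  proof -
    have "(\<Sum>i\<in>UNIV. \<Sum>j\<in>UNIV. \<Sum>k\<in>UNIV. D z i j k * (w $ i * w $ j * w $ k))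
       = (\<Sum>i\<in>UNIV. \<Sum>j\<in>UNIV. delta i j * (w $ i * w $ j * (\<Sum>k\<in>UNIV. z $ k * w $ k)))
       + (\<Sum>i\<in>UNIV. \<Sum>j\<in>UNIV. \<Sum>k\<in>UNIV. delta i k * (w $ i * (z $ j * w $ j) * w $ k))
       + (\<Sum>i\<in>UNIV. \<Sum>j\<in>UNIV. \<Sum>k\<in>UNIV. delta j k * (w $ j * (z $ i * w $ i) * w $ k))"
      by (simp add: D_def sum.distrib sum_distrib_left algebra_simps)
    also have "(\<Sum>i\<in>UNIV. \<Sum>j\<in>UNIV. delta i j * (w $ i * w $ j * (\<Sum>k\<in>UNIV. z $ k * w $ k)))
        = (\<Sum>i\<in>UNIV. w $ i * w $ i) * (z \<bullet> w)"
      by (simp only: sum_delta inner_vec_def inner_real_def sum_distrib_right)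
    also have "(\<Sum>i\<in>UNIV. \<Sum>j\<in>UNIV. \<Sum>k\<in>UNIV. delta i k * (w $ i * (z $ j * w $ j) * w $ k))
        = (\<Sum>i\<in>UNIV. w $ i * w $ i) * (z \<bullet> w)"
      by (simp add: sum_delta inner_vec_def sum_product) (simp add: algebra_simps)
    also have "(\<Sum>i\<in>UNIV. \<Sum>j\<in>UNIV. \<Sum>k\<in>UNIV. delta j k * (w $ j * (z $ i * w $ i) * w $ k))
        = (z \<bullet> w) * (\<Sum>i\<in>UNIV. w $ i * w $ i)"
      by (simp add: sum_delta inner_vec_def sum_product) (simp add: algebra_simps)
    finally show ?thesis using unit_sum_squares[OF that] by simp
  qed
  have XX: "(\<Sum>i\<in>UNIV. \<Sum>j\<in>UNIV. \<Sum>k\<in>UNIV. (x $ i * x $ j * x $ k) * (y $ i * y $ j * y $ k)) = (x \<bullet> y) ^ 3"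
    by (simp add: inner_vec_def power3_eq_cube sum_product sum_distrib_left sum_distrib_right algebra_simps)
  \<comment> \<open>Of the nine products of delta terms, the three pairings of like terms give
    \<open>n\<close> times the inner product each, the six mixed ones give it once each:
    \<open>3 * n + 6\<close> in total.\<close>
  have DD: "(\<Sum>i\<in>UNIV. \<Sum>j\<in>UNIV. \<Sum>k\<in>UNIV. D x i j k * D y i j k) = 3 * (?n + 2) * (x \<bullet> y)"
  proof -
    have inner: "(\<Sum>k\<in>UNIV. D x i j k * D y i j k)
      = delta i j * (x \<bullet> y) + x $ j * y $ j + x $ i * y $ i
        + delta i j * (2 * (x $ i * y $ j + x $ j * y $ i)) + delta i j * (x $ j * y $ i + x $ i * y $ j)" for i j
    proof -
      have e: "D x i j k * D y i j k = delta i j * (x $ k * y $ k)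
          + delta i k * (delta i j * (x $ k * y $ j + x $ j * y $ k) + x $ j * y $ j)
          + delta j k * (delta i j * (x $ k * y $ i + x $ i * y $ k) + x $ i * y $ i)
          + delta i k * (delta i j * (x $ j * y $ i + x $ i * y $ j))" for k
        by (auto simp: D_def delta_def algebra_simps)
      show ?thesis
        unfolding e by (simp add: sum.distrib sum_delta inner_vec_def flip: sum_distrib_left) (simp add: algebra_simps)
    qed
    have xy: "(\<Sum>j\<in>UNIV. x $ j * y $ j) = x \<bullet> y" by (simp add: inner_vec_def)
    have "(\<Sum>j\<in>UNIV. \<Sum>k\<in>UNIV. D x i j k * D y i j k) = 2 * (x \<bullet> y) + (?n + 6) * (x $ i * y $ i)" for i
      unfolding inner by (simp only: sum.distrib sum_delta xy) (simp add: algebra_simps)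
    then show ?thesis
      by (simp add: sum.distrib xy flip: sum_distrib_left) (simp add: algebra_simps)
  qed
  have H: "harmonic3 (i, j, k) z = z $ i * z $ j * z $ k - D z i j k / (?n + 2)" for z :: "real ^ 'n" and i j k
    by (simp add: harmonic3_def D_def)
  have "(p - d / m) * (q - e / m) = p * q - d * q / m - e * p / m + d * e / m\<^sup>2" for p q d e m :: real
    by (simp add: algebra_simps power2_eq_square)
  then have "harmonic3 (i, j, k) x * harmonic3 (i, j, k) y
      = (x $ i * x $ j * x $ k) * (y $ i * y $ j * y $ k)
        - (D x i j k * (y $ i * y $ j * y $ k)) / (?n + 2) - (D y i j k * (x $ i * x $ j * x $ k)) / (?n + 2)
        + (D x i j k * D y i j k) / (?n + 2)\<^sup>2" for i j k
    unfolding H by blast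
  then have "(\<Sum>m\<in>UNIV. harmonic3 m x * harmonic3 m y)
     = (\<Sum>i\<in>UNIV. \<Sum>j\<in>UNIV. \<Sum>k\<in>UNIV. (x $ i * x $ j * x $ k) * (y $ i * y $ j * y $ k))
     - (\<Sum>i\<in>UNIV. \<Sum>j\<in>UNIV. \<Sum>k\<in>UNIV. D x i j k * (y $ i * y $ j * y $ k)) / (?n + 2)
     - (\<Sum>i\<in>UNIV. \<Sum>j\<in>UNIV. \<Sum>k\<in>UNIV. D y i j k * (x $ i * x $ j * x $ k)) / (?n + 2)
     + (\<Sum>i\<in>UNIV. \<Sum>j\<in>UNIV. \<Sum>k\<in>UNIV. D x i j k * D y i j k) / (?n + 2)\<^sup>2"
    by (simp add: UNIV_Times_UNIV[symmetric] sum.cartesian_product' sum.distrib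
        sum_subtractf sum_divide_distrib del: UNIV_Times_UNIV)
  also have "\<dots> = (x \<bullet> y) ^ 3 - 3 * (x \<bullet> y) / (?n + 2) - 3 * (x \<bullet> y) / (?n + 2)
      + 3 * (?n + 2) * (x \<bullet> y) / (?n + 2)\<^sup>2"
    by (simp only: XX DX[OF assms(1)] DX[OF assms(2)] DD inner_commute[of y x])
  also have "\<dots> = (x \<bullet> y) ^ 3 - 3 / (CARD('n) + 2) * (x \<bullet> y)"
  proof -
    have "3 * m * w / m\<^sup>2 = 3 * w / m" if "m \<noteq> 0" for m w :: real
      using that by (simp add: power2_eq_square)
    from this[of "?n + 2" "x \<bullet> y"] show ?thesis by simp
  qed
  finally show ?thesis by simp
qed

lemma power_sum_3:
  fixes C :: "(real ^ 'n) set"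
  assumes "C \<subseteq> sphere 0 1"
  shows "power_sum 3 C - 3 / (CARD('n) + 2) * power_sum 1 C = (\<Sum>m\<in>UNIV. (\<Sum>x\<in>C. harmonic3 m x)\<^sup>2)"
proof -
  have "(\<Sum>x\<in>C. \<Sum>y\<in>C. (x \<bullet> y) ^ 3 - 3 / (CARD('n) + 2) * (x \<bullet> y)) = (\<Sum>m\<in>UNIV. (\<Sum>x\<in>C. harmonic3 m x)\<^sup>2)"
    by (rule sum_kernel, simp, rule kernel_3) (use assms in auto)
  then show ?thesis
    by (simp add: power_sum_def sum_subtractf sum_distrib_left)
qed

section \<open>Moments of the surface measure\<close>

text \<open>Boxes determine Lebesgue measure, and the preimage of a box is its image under the
  inverse map, which is orthogonal too and so preserves volume.\<close>

lemma distr_lborel_orthogonal: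
  fixes f :: "real ^ 'n::{finite,wellorder} \<Rightarrow> real ^ 'n::_"
  assumes f: "orthogonal_transformation f"
  shows "distr lborel borel f = lborel"
proof (rule lborel_eqI[symmetric])
  have meas: "f \<in> lborel \<rightarrow>\<^sub>M borel"
    using linear_continuous_on[of f UNIV] orthogonal_transformation_linear[OF f]
    by (auto simp: linear_conv_bounded_linear intro: borel_measurable_continuous_onI)
  fix l u :: "real ^ 'n::_" assume le: "\<And>b. b \<in> Basis \<Longrightarrow> l \<bullet> b \<le> u \<bullet> b"
  have g: "orthogonal_transformation (inv f)" by (rule orthogonal_transformation_inv[OF f])
  have img: "f -` box l u = inv f ` box l u"
    using orthogonal_transformation_bij[OF f] by (simp add: bij_vimage_eq_inv_image)
  have "emeasure (distr lborel borel f) (box l u) = emeasure lborel (f -` box l u)"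
    using meas by (simp add: emeasure_distr)
  also have "\<dots> = emeasure lebesgue (inv f ` box l u)"
    using measurable_sets[OF meas, of "box l u"] by (simp add: img)
  also have "\<dots> = emeasure lebesgue (box l u)"
    using measurable_orthogonal_image[OF g lmeasurable_box] measure_orthogonal_image[OF g lmeasurable_box]
    by (simp add: emeasure_eq_measure2)
  also have "\<dots> = (\<Prod>b\<in>Basis. (u - l) \<bullet> b)"
    using le by simp
  finally show "emeasure (distr lborel borel f) (box l u) = (\<Prod>b\<in>Basis. (u - l) \<bullet> b)" .
qed simp

lemma measurable_normalize [measurable]:
  "(\<lambda>x :: real ^ 'n. x /\<^sub>R norm x) \<in> borel_measurable borel"
  by measurable

lemma prob_space_uniform_ball: "prob_space (uniform_measure lborel (ball 0 1 :: (real ^ 'n) set))"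
proof (rule prob_space_uniform_measure)
  have "emeasure lborel (ball 0 1 :: (real ^ 'n) set) = 0 \<Longrightarrow> False"
    using open_not_negligible[of "ball 0 1 :: (real ^ 'n) set"]
    by (simp add: negligible_iff_null_sets null_setsI)
  then show "emeasure lborel (ball 0 1 :: (real ^ 'n) set) \<noteq> 0" by blast
  show "emeasure lborel (ball 0 1 :: (real ^ 'n) set) \<noteq> \<infinity>"
    using emeasure_lborel_ball_finite[of "0 :: real ^ 'n" 1] by auto
qed

lemma prob_space_sphere_measure: "prob_space (sphere_measure :: (real ^ 'n) measure)"
  unfolding sphere_measure_def
  by (rule prob_space.prob_space_distr[OF prob_space_uniform_ball]) simp

lemma sets_sphere_measure [measurable_cong, simp]: "sets sphere_measure = sets borel"
  by (simp add: sphere_measure_def)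

lemma space_sphere_measure [simp]: "space sphere_measure = UNIV"
  by (simp add: sphere_measure_def)

lemma AE_sphere_measure: "AE x in sphere_measure. norm (x :: real ^ 'n) = 1"
proof -
  have "AE x in uniform_measure lborel (ball 0 1). norm (x /\<^sub>R norm x :: real ^ 'n) = 1"
    by (rule AE_uniform_measureI, simp)
      (use AE_lborel_singleton[of 0] in eventually_elim, simp)
  then show ?thesis
    unfolding sphere_measure_def by (subst AE_distr_iff) auto
qed

text \<open>An orthogonal map preserves the uniform measure on the ball and commutes with
  normalization.\<close>

lemma distr_sphere_measure_orthogonal:
  fixes f :: "real ^ 'n::{finite,wellorder} \<Rightarrow> real ^ 'n::_"
  assumes f: "orthogonal_transformation f"
  shows "distr sphere_measure borel f = sphere_measure"
proof -
  let ?B = "ball 0 1 :: (real ^ 'n::_) set"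
  let ?U = "uniform_measure lborel ?B"
  have meas [measurable]: "f \<in> borel \<rightarrow>\<^sub>M borel"
    using linear_continuous_on[of f UNIV] orthogonal_transformation_linear[OF f]
    by (auto simp: linear_conv_bounded_linear intro: borel_measurable_continuous_onI)
  have U: "distr ?U borel f = ?U"
  proof (rule measure_eqI)
    fix X assume "X \<in> sets (distr ?U borel f)"
    then have [measurable]: "X \<in> sets borel" by simp
    have "f -` X \<in> sets borel" using measurable_sets[OF meas, of X] by simp
    then have "emeasure (distr ?U borel f) X = emeasure lborel (?B \<inter> f -` X) / emeasure lborel ?B"
      by (subst emeasure_distr) auto
    also have "?B \<inter> f -` X = f -` (?B \<inter> X)"
      using orthogonal_transformation_norm[OF f] by auto
    also have "emeasure lborel (f -` (?B \<inter> X)) = emeasure (distr lborel borel f) (?B \<inter> X)"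
      by (subst emeasure_distr) auto
    also have "\<dots> = emeasure lborel (?B \<inter> X)"
      by (simp only: distr_lborel_orthogonal[OF f])
    finally show "emeasure (distr ?U borel f) X = emeasure ?U X" by simp
  qed simp
  have "distr sphere_measure borel f = distr ?U borel (f \<circ> (\<lambda>x. x /\<^sub>R norm x))"
    unfolding sphere_measure_def by (subst distr_distr) auto
  also have "f \<circ> (\<lambda>x. x /\<^sub>R norm x) = (\<lambda>x. x /\<^sub>R norm x) \<circ> f"
    by (auto simp: orthogonal_transformation_scaleR[OF f] orthogonal_transformation_norm[OF f])
  also have "distr ?U borel ((\<lambda>x. x /\<^sub>R norm x) \<circ> f) = distr (distr ?U borel f) borel (\<lambda>x. x /\<^sub>R norm x)"
    by (subst distr_distr) auto
  finally show ?thesis unfolding U sphere_measure_def .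
qed

lemma integral_sphere_measure_orthogonal:
  fixes f :: "real ^ 'n::{finite,wellorder} \<Rightarrow> real ^ 'n::_" and g :: "real ^ 'n::_ \<Rightarrow> real"
  assumes f: "orthogonal_transformation f" and [measurable]: "g \<in> borel_measurable borel"
  shows "(\<integral>x. g (f x) \<partial>sphere_measure) = (\<integral>x. g x \<partial>sphere_measure)"
proof -
  have [measurable]: "f \<in> borel \<rightarrow>\<^sub>M borel"
    using linear_continuous_on[of f UNIV] orthogonal_transformation_linear[OF f]
    by (auto simp: linear_conv_bounded_linear intro: borel_measurable_continuous_onI)
  have "(\<integral>x. g x \<partial>distr sphere_measure borel f) = (\<integral>x. g (f x) \<partial>sphere_measure)"
    by (rule integral_distr) auto
  then show ?thesis by (simp only: distr_sphere_measure_orthogonal[OF f])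
qed

text \<open>By invariance the integral equals its own negative.\<close>

lemma integral_sphere_measure_odd:
  fixes g :: "real ^ 'n::{finite,wellorder} \<Rightarrow> real"
  assumes "g \<in> borel_measurable borel" "orthogonal_transformation f" "\<And>x. g (f x) = - g x"
  shows "(\<integral>x. g x \<partial>sphere_measure) = 0"
  using integral_sphere_measure_orthogonal[OF assms(2,1)] by (simp add: assms(3))

lemma integrable_sphere_measure:
  fixes g :: "real ^ 'n \<Rightarrow> real"
  assumes [measurable]: "g \<in> borel_measurable borel" and "\<And>x. norm x = 1 \<Longrightarrow> \<bar>g x\<bar> \<le> B"
  shows "integrable sphere_measure g"
proof -
  interpret prob_space "sphere_measure :: (real ^ 'n) measure" by (rule prob_space_sphere_measure)
  have "AE x in sphere_measure. norm (g x) \<le> B"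
    using AE_sphere_measure by eventually_elim (simp add: assms(2))
  then show ?thesis by (rule integrable_const_bound) simp
qed

lemma sphere_measure_moment_1:
  "(\<integral>x. x $ i \<partial>(sphere_measure :: (real ^ 'n::{finite,wellorder}) measure)) = 0"
  by (rule integral_sphere_measure_odd[where f = "\<lambda>x. - x"])
    (auto simp: orthogonal_transformation_neg)

lemma sphere_measure_moment_3:
  "(\<integral>x. x $ i * (x $ j * x $ k) \<partial>(sphere_measure :: (real ^ 'n::{finite,wellorder}) measure)) = 0"
  by (rule integral_sphere_measure_odd[where f = "\<lambda>x. - x"])
    (auto simp: orthogonal_transformation_neg)

text \<open>Off the diagonal, flipping the sign of coordinate \<open>i\<close> negates the
  integrand. On the diagonal, swapping coordinates shows that all these moments agree, and their sum
  is 1 because almost every point has norm 1.\<close>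

lemma sphere_measure_moment_2:
  "(\<integral>x. x $ i * x $ j \<partial>(sphere_measure :: (real ^ 'n::{finite,wellorder}) measure))
     = (if i = j then 1 / CARD('n) else 0)"
proof (cases "i = j")
  case False
  let ?f = "\<lambda>x :: real ^ 'n::_. \<chi> k. if k = i then - x $ k else x $ k"
  have "orthogonal_transformation ?f"
    unfolding orthogonal_transformation_def
    by (auto intro!: linearI sum.cong simp: vec_eq_iff inner_vec_def)
  then have "(\<integral>x. x $ i * x $ j \<partial>(sphere_measure :: (real ^ 'n::_) measure)) = 0"
    by (rule integral_sphere_measure_odd[rotated]) (use False in auto)
  with False show ?thesis by simp
next
  case True
  interpret prob_space "sphere_measure :: (real ^ 'n::_) measure" by (rule prob_space_sphere_measure)
  have int: "integrable sphere_measure (\<lambda>x :: real ^ 'n::_. x $ k * x $ k)" for k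
  proof (rule integrable_sphere_measure)
    fix x :: "real ^ 'n::_" assume "norm x = 1"
    then have "\<bar>x $ k\<bar> \<le> 1" using component_le_norm_cart[of x k] by simp
    then show "\<bar>x $ k * x $ k\<bar> \<le> 1" using abs_square_le_1[of "x $ k"] by (simp add: power2_eq_square)
  qed auto
  have eq: "(\<integral>x. x $ k * x $ k \<partial>(sphere_measure :: (real ^ 'n::_) measure)) = (\<integral>x. x $ i * x $ i \<partial>sphere_measure)" for k
  proof -
    let ?p = "Transposition.transpose i k"
    let ?f = "\<lambda>x :: real ^ 'n::_. \<chi> m. x $ ?p m"
    have "orthogonal_transformation ?f"
      unfolding orthogonal_transformation_def
    proof (intro conjI allI)
      show "linear ?f" by (auto intro!: linearI simp: vec_eq_iff)
      fix v w :: "real ^ 'n::_"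
      have "(\<Sum>m\<in>UNIV. v $ ?p m * w $ ?p m) = (\<Sum>m\<in>UNIV. v $ m * w $ m)"
        by (rule sum.reindex_bij_betw) simp
      then show "?f v \<bullet> ?f w = v \<bullet> w" by (simp add: inner_vec_def)
    qed
    from integral_sphere_measure_orthogonal[OF this, of "\<lambda>x. x $ i * x $ i"] show ?thesis by simp
  qed
  have "(1 :: real) = (\<integral>x. 1 \<partial>(sphere_measure :: (real ^ 'n::_) measure))" using prob_space by simp
  also have "\<dots> = (\<integral>x. (\<Sum>k\<in>UNIV. x $ k * x $ k) \<partial>(sphere_measure :: (real ^ 'n::_) measure))"
  proof (rule integral_cong_AE)
    show "AE x in sphere_measure. 1 = (\<Sum>k\<in>UNIV. (x :: real ^ 'n::_) $ k * x $ k)"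
      using AE_sphere_measure by eventually_elim (simp add: norm_eq_1 inner_vec_def)
  qed auto
  also have "\<dots> = (\<Sum>k\<in>UNIV. \<integral>x. x $ k * x $ k \<partial>(sphere_measure :: (real ^ 'n::_) measure))"
    by (rule Bochner_Integration.integral_sum) (rule int)
  also have "\<dots> = (\<Sum>k\<in>(UNIV :: 'n set). \<integral>x. x $ i * x $ i \<partial>(sphere_measure :: (real ^ 'n::_) measure))"
    by (intro sum.cong refl eq)
  also have "\<dots> = CARD('n) * (\<integral>x. x $ i * x $ i \<partial>(sphere_measure :: (real ^ 'n::_) measure))"
    by simp
  finally show ?thesis using True by (simp add: field_simps)
qed

section \<open>Monomials of degree at most 3 and the design criterion\<close>

definition monomial :: "('n \<Rightarrow> nat) \<Rightarrow> real ^ 'n \<Rightarrow> real" where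
  "monomial \<alpha> x = (\<Prod>i\<in>UNIV. (x $ i) ^ \<alpha> i)"

lemma monomial_0: "(\<Sum>i\<in>UNIV. \<alpha> i) = 0 \<Longrightarrow> monomial \<alpha> x = 1"
  by (simp add: monomial_def)

lemma monomial_Suc:
  fixes \<alpha> :: "'n::finite \<Rightarrow> nat"
  assumes "(\<Sum>i\<in>UNIV. \<alpha> i) = Suc d"
  obtains i \<beta> where "(\<Sum>i\<in>UNIV. \<beta> i) = d" "\<And>x. monomial \<alpha> x = x $ i * monomial \<beta> x"
proof -
  have "\<exists>i. \<alpha> i \<noteq> 0" using assms by (metis sum.neutral nat.distinct(1))
  then obtain i where i: "\<alpha> i \<noteq> 0" by blast
  let ?\<beta> = "\<alpha>(i := \<alpha> i - 1)"
  have "(\<Sum>j\<in>UNIV. \<alpha> j) = \<alpha> i + (\<Sum>j\<in>UNIV - {i}. \<alpha> j)" by (simp add: sum.remove)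
  moreover have "(\<Sum>j\<in>UNIV. ?\<beta> j) = (\<alpha> i - 1) + (\<Sum>j\<in>UNIV - {i}. \<alpha> j)"
    by (subst sum.remove[of _ i]) (auto intro!: sum.cong)
  ultimately have "(\<Sum>j\<in>UNIV. ?\<beta> j) = d" using i assms by simp
  moreover have "monomial \<alpha> x = x $ i * monomial ?\<beta> x" for x
  proof -
    have "monomial \<alpha> x = (x $ i) ^ \<alpha> i * (\<Prod>j\<in>UNIV - {i}. (x $ j) ^ \<alpha> j)"
      unfolding monomial_def by (subst prod.remove[of _ i]) auto
    moreover have "monomial ?\<beta> x = (x $ i) ^ (\<alpha> i - 1) * (\<Prod>j\<in>UNIV - {i}. (x $ j) ^ \<alpha> j)"
      unfolding monomial_def by (subst prod.remove[of _ i]) (auto intro!: prod.cong)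
    ultimately show ?thesis using i by (simp add: power_eq_if)
  qed
  ultimately show thesis by (rule that)
qed

text \<open>Peeling off one variable at a time turns exponent vectors into the index form in which
  the moments are stated.\<close>

lemma monomial_degree_le_3_cases:
  assumes "(\<Sum>i\<in>UNIV. \<alpha> i) \<le> 3"
  obtains "monomial \<alpha> = (\<lambda>x. 1)" | i where "monomial \<alpha> = (\<lambda>x. x $ i)"
    | i j where "monomial \<alpha> = (\<lambda>x. x $ i * x $ j)"
    | i j k where "monomial \<alpha> = (\<lambda>x. x $ i * (x $ j * x $ k))"
proof -
  have d1: "\<exists>i. \<forall>x. monomial \<beta> x = x $ i" if "(\<Sum>i\<in>UNIV. \<beta> i) = Suc 0" for \<beta> :: "'a \<Rightarrow> nat"
    using monomial_Suc[OF that] monomial_0 by (metis mult.right_neutral)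
  have d2: "\<exists>i j. \<forall>x. monomial \<beta> x = x $ i * x $ j" if "(\<Sum>i\<in>UNIV. \<beta> i) = Suc (Suc 0)" for \<beta> :: "'a \<Rightarrow> nat"
    using monomial_Suc[OF that] d1 by metis
  have d3: "\<exists>i j k. \<forall>x. monomial \<beta> x = x $ i * (x $ j * x $ k)" if "(\<Sum>i\<in>UNIV. \<beta> i) = Suc (Suc (Suc 0))" for \<beta> :: "'a \<Rightarrow> nat"
    using monomial_Suc[OF that] d2 by metis
  consider "(\<Sum>i\<in>UNIV. \<alpha> i) = 0" | "(\<Sum>i\<in>UNIV. \<alpha> i) = Suc 0" | "(\<Sum>i\<in>UNIV. \<alpha> i) = Suc (Suc 0)"
    | "(\<Sum>i\<in>UNIV. \<alpha> i) = Suc (Suc (Suc 0))"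
    using assms by linarith
  then show thesis
  proof cases
    case 1
    from monomial_0[OF this] show ?thesis by (intro that(1) ext)
  next
    case 2
    then show ?thesis using d1[OF 2] that(2) by blast
  next
    case 3
    then show ?thesis using d2[OF 3] that(3) by blast
  next
    case 4
    then show ?thesis using d3[OF 4] that(4) by blast
  qed
qed

lemma integrable_monomial: "integrable sphere_measure (monomial \<alpha> :: real ^ 'n \<Rightarrow> real)"
proof (rule integrable_sphere_measure)
  show "(monomial \<alpha> :: real ^ 'n \<Rightarrow> real) \<in> borel_measurable borel"
    unfolding monomial_def by measurable
  fix x :: "real ^ 'n" assume "norm x = 1"
  then have "\<bar>x $ i\<bar> \<le> 1" for i using component_le_norm_cart[of x i] by simp
  then show "\<bar>monomial \<alpha> x\<bar> \<le> 1"
    unfolding monomial_def abs_prod by (intro prod_le_1) (simp add: power_abs power_le_one)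
qed

text \<open>By linearity it suffices to compare monomials, and the assumed sums are
  \<open>card C\<close> times the moments of the surface measure.\<close>

lemma spherical_design_3I:
  fixes C :: "(real ^ 'n::{finite,wellorder}) set"
  assumes C: "spherical_code C" "C \<noteq> {}"
    and m1: "\<And>i. (\<Sum>x\<in>C. x $ i) = 0"
    and m2: "\<And>i j. (\<Sum>x\<in>C. x $ i * x $ j) = (if i = j then real (card C) / CARD('n) else 0)"
    and m3: "\<And>i j k. (\<Sum>x\<in>C. x $ i * x $ j * x $ k) = 0"
  shows "spherical_design 3 C"
  unfolding spherical_design_def
proof (intro conjI allI impI C(1))
  interpret prob_space "sphere_measure :: (real ^ 'n::_) measure" by (rule prob_space_sphere_measure)
  have N: "real (card C) > 0" using C by (simp add: spherical_code_def card_gt_0_iff)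
  have mono: "(\<Sum>x\<in>C. monomial \<alpha> x) / real (card C) = (\<integral>x. monomial \<alpha> x \<partial>sphere_measure)"
    if "(\<Sum>i\<in>UNIV. \<alpha> i) \<le> 3" for \<alpha> :: "'n \<Rightarrow> nat"
    using that
  proof (cases rule: monomial_degree_le_3_cases)
    case 1
    then show ?thesis using N prob_space by simp
  next
    case (2 i)
    then show ?thesis by (simp add: m1 sphere_measure_moment_1)
  next
    case (3 i j)
    then show ?thesis using N by (simp add: m2 sphere_measure_moment_2)
  next
    case (4 i j k)
    then show ?thesis using m3[of i j k] by (simp add: sphere_measure_moment_3 mult.assoc)
  qed
  fix p :: "real ^ 'n::_ \<Rightarrow> real" assume "polynomial_of_degree_le 3 p"
  then obtain c where c: "\<And>x. p x = (\<Sum>\<alpha> | (\<Sum>i\<in>UNIV. \<alpha> i) \<le> 3. c \<alpha> * monomial \<alpha> x)"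
    unfolding polynomial_of_degree_le_def monomial_def by blast
  have "(\<Sum>x\<in>C. p x) / real (card C)
      = (\<Sum>\<alpha> | (\<Sum>i\<in>UNIV. \<alpha> i) \<le> 3. c \<alpha> * ((\<Sum>x\<in>C. monomial \<alpha> x) / real (card C)))"
    unfolding c by (subst sum.swap) (simp add: sum_divide_distrib sum_distrib_left)
  also have "\<dots> = (\<Sum>\<alpha> | (\<Sum>i\<in>UNIV. \<alpha> i) \<le> 3. \<integral>x. c \<alpha> * monomial \<alpha> x \<partial>sphere_measure)"
    by (intro sum.cong) (simp_all add: mono)
  also have "\<dots> = (\<integral>x. p x \<partial>sphere_measure)"
    unfolding c by (rule Bochner_Integration.integral_sum[symmetric]) (simp add: integrable_monomial)
  finally show "(\<Sum>x\<in>C. p x) / real (card C) = (\<integral>x. p x \<partial>sphere_measure)" .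
qed

section \<open>The linear programming bound\<close>

lemma sum_pairs:
  fixes f :: "real \<Rightarrow> real" and C :: "(real ^ 'n) set"
  assumes "finite C" "C \<subseteq> sphere 0 1"
  shows "(\<Sum>x\<in>C. \<Sum>y\<in>C. f (x \<bullet> y)) = energy f C + real (card C) * f 1"
proof -
  have "(\<Sum>x\<in>C. \<Sum>y\<in>C. f (x \<bullet> y)) = (\<Sum>(x, y)\<in>C \<times> C. f (x \<bullet> y))"
    by (simp add: sum.cartesian_product)
  also have "C \<times> C = {(x, y). x \<in> C \<and> y \<in> C \<and> x \<noteq> y} \<union> (\<lambda>x. (x, x)) ` C"
    by auto
  also have "(\<Sum>(x, y)\<in>\<dots>. f (x \<bullet> y)) = energy f C + (\<Sum>(x, y)\<in>(\<lambda>x. (x, x)) ` C. f (x \<bullet> y))"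
    unfolding energy_def using assms(1)
    by (intro sum.union_disjoint) (auto intro: finite_subset[of _ "C \<times> C"])
  also have "(\<Sum>(x, y)\<in>(\<lambda>x. (x, x)) ` C. f (x \<bullet> y)) = (\<Sum>x\<in>C. f (x \<bullet> x))"
    by (subst sum.reindex) (auto simp: inj_on_def)
  also have "\<dots> = (\<Sum>x\<in>C. f 1)"
    using assms(2) by (intro sum.cong) (auto simp: norm_eq_1)
  finally show ?thesis by simp
qed

lemma inner_unit_bounds:
  fixes x y :: "real ^ 'n"
  assumes "norm x = 1" "norm y = 1" "x \<noteq> y"
  shows "x \<bullet> y \<in> {-1..<1}"
proof -
  have "\<bar>x \<bullet> y\<bar> \<le> 1" using Cauchy_Schwarz_ineq2[of x y] assms by simp
  moreover have "x \<bullet> y \<noteq> 1"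
    using assms norm_cauchy_schwarz_eq[of x y] by auto
  ultimately show ?thesis by auto
qed

lemma finite_pairs: "finite C \<Longrightarrow> finite {(x, y). x \<in> C \<and> y \<in> C \<and> x \<noteq> y}"
  by (rule finite_subset[of _ "C \<times> C"]) auto

definition target_energy :: "(real \<Rightarrow> real) \<Rightarrow> real" where
  "target_energy h = 2048 * (253 * h (-9/23) + 1288 * h (-1/23) + 506 * h (7/23))"

abbreviation lp_cubic :: "real \<Rightarrow> real \<Rightarrow> real \<Rightarrow> real \<Rightarrow> real \<Rightarrow> real" where
  "lp_cubic \<equiv> newton_cubic (-9/23) (-1/23) (7/23)"

text \<open>All coefficients of \<open>m1\<close>, \<open>m2\<close>, \<open>m3\<close> being nonnegative says that the Newton basis polynomials
  at the three inner products have nonnegative Gegenbauer coefficients in dimension 23; for the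
  cubic one, \<open>62/13225 = 3/25 - 61/529\<close>.\<close>

lemma energy_lp_cubic:
  fixes C :: "(real ^ 23) set"
  assumes C: "spherical_code C" "card C = 2048"
  defines "m1 \<equiv> power_sum 1 C" and "m2 \<equiv> power_sum 2 C - 2048\<^sup>2 / 23"
    and "m3 \<equiv> power_sum 3 C - 3 / 25 * power_sum 1 C"
  shows "energy (lp_cubic A\<^sub>0 A\<^sub>1 A\<^sub>2 A\<^sub>3) C = target_energy (lp_cubic A\<^sub>0 A\<^sub>1 A\<^sub>2 A\<^sub>3)
    + A\<^sub>1 * m1 + A\<^sub>2 * (m2 + 10 / 23 * m1) + A\<^sub>3 * (m3 + 3 / 23 * m2 + 62 / 13225 * m1)"
proof -
  let ?f = "lp_cubic A\<^sub>0 A\<^sub>1 A\<^sub>2 A\<^sub>3"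
  \<comment> \<open>The coefficients in powers of \<open>t\<close>: the three nodes have elementary
    symmetric functions -3/23, -61/529 and 63/12167; the first two nodes have sum -10/23 and product
    9/529.\<close>
  define c0 where "c0 = A\<^sub>0 + 9 / 23 * A\<^sub>1 + 9 / 529 * A\<^sub>2 - 63 / 12167 * A\<^sub>3"
  define c1 where "c1 = A\<^sub>1 + 10 / 23 * A\<^sub>2 - 61 / 529 * A\<^sub>3"
  define c2 where "c2 = A\<^sub>2 + 3 / 23 * A\<^sub>3"
  have f: "?f t = c0 * t ^ 0 + c1 * t ^ 1 + c2 * t ^ 2 + A\<^sub>3 * t ^ 3" for t
    by (simp add: newton_cubic_def c0_def c1_def c2_def field_simps power2_eq_square power3_eq_cube)
  have "(\<Sum>x\<in>C. \<Sum>y\<in>C. ?f (x \<bullet> y))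
      = c0 * power_sum 0 C + c1 * power_sum 1 C + c2 * power_sum 2 C + A\<^sub>3 * power_sum 3 C"
    unfolding f power_sum_def by (simp only: sum.distrib sum_distrib_left)
  moreover have "(\<Sum>x\<in>C. \<Sum>y\<in>C. ?f (x \<bullet> y)) = energy ?f C + 2048 * ?f 1"
    using C by (subst sum_pairs) (auto simp: spherical_code_def)
  ultimately have "energy ?f C
      = c0 * 2048\<^sup>2 + c1 * m1 + c2 * (m2 + 2048\<^sup>2 / 23) + A\<^sub>3 * (m3 + 3 / 25 * m1) - 2048 * ?f 1"
    using C(2) by (simp add: power_sum_0 m1_def m2_def m3_def)
  \<comment> \<open>What remains is the quadrature rule: 1, 253, 1288, 506 at 1 and the three nodes
    have moments 2048, 0, 2048/23, 0, so the terms free of \<open>m1\<close>, \<open>m2\<close>,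
    \<open>m3\<close> add up to the target energy.\<close>
  then show ?thesis
    unfolding f by (simp add: target_energy_def f c0_def c1_def c2_def power2_eq_square power3_eq_cube field_simps)
qed

lemma lp_moments_nonneg:
  fixes C :: "(real ^ 23) set"
  assumes C: "spherical_code C" "card C = 2048"
  shows "power_sum 1 C \<ge> 0" "power_sum 2 C - 2048\<^sup>2 / 23 \<ge> 0" "power_sum 3 C - 3 / 25 * power_sum 1 C \<ge> 0"
proof -
  have S: "C \<subseteq> sphere 0 1" using C by (simp add: spherical_code_def)
  show "power_sum 1 C \<ge> 0" by (simp only: power_sum_1) (simp add: sum_nonneg)
  show "power_sum 2 C - 2048\<^sup>2 / 23 \<ge> 0"
    using power_sum_2[OF S] C(2) by (simp add: sum_nonneg case_prod_unfold)
  show "power_sum 3 C - 3 / 25 * power_sum 1 C \<ge> 0"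
    using power_sum_3[OF S] by (simp add: sum_nonneg)
qed

text \<open>Each power sum is a sum of squares, so every feature sum vanishes. In degree 3 the trace
  corrections involve first moments only, which are already 0.\<close>

lemma lp_moments_eq_0D:
  fixes C :: "(real ^ 23) set"
  assumes C: "spherical_code C" "card C = 2048"
    and m: "power_sum 1 C = 0" "power_sum 2 C - 2048\<^sup>2 / 23 = 0" "power_sum 3 C - 3 / 25 * power_sum 1 C = 0"
  shows "(\<Sum>x\<in>C. x $ i) = 0" "(\<Sum>x\<in>C. x $ i * x $ j) = 2048 / 23 * delta i j"
    "(\<Sum>x\<in>C. x $ i * x $ j * x $ k) = 0"
proof -
  have S: "C \<subseteq> sphere 0 1" using C by (simp add: spherical_code_def)
  have "(\<Sum>i\<in>UNIV. (\<Sum>x\<in>C. x $ i)\<^sup>2) = 0" using m(1) by (simp only: power_sum_1)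
  then show 1: "(\<Sum>x\<in>C. x $ i) = 0" for i by (simp add: sum_nonneg_eq_0_iff)
  have "(\<Sum>(i, j)\<in>UNIV. (\<Sum>x\<in>C. x $ i * x $ j - delta i j / 23)\<^sup>2) = 0"
    using power_sum_2[OF S] m(2) C(2) by simp
  then have "(\<Sum>x\<in>C. x $ i * x $ j - delta i j / 23) = 0"
    by (simp add: sum_nonneg_eq_0_iff case_prod_unfold)
  then show "(\<Sum>x\<in>C. x $ i * x $ j) = 2048 / 23 * delta i j"
    using C(2) by (simp add: sum_subtractf)
  have "(\<Sum>m\<in>UNIV. (\<Sum>x\<in>C. harmonic3 m x)\<^sup>2) = 0"
    using power_sum_3[OF S] m(3) by simp
  then have "(\<Sum>x\<in>C. harmonic3 (i, j, k) x) = 0"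
    by (simp add: sum_nonneg_eq_0_iff)
  moreover have "(\<Sum>x\<in>C. harmonic3 (i, j, k) x) = (\<Sum>x\<in>C. x $ i * x $ j * x $ k)
      - (delta i j * (\<Sum>x\<in>C. x $ k) + delta i k * (\<Sum>x\<in>C. x $ j) + delta j k * (\<Sum>x\<in>C. x $ i)) / 25"
    by (simp add: harmonic3_def sum_subtractf sum_distrib_left sum.distrib flip: sum_divide_distrib)
  ultimately show "(\<Sum>x\<in>C. x $ i * x $ j * x $ k) = 0" by (simp add: 1)
qed

text \<open>The two ends of \<open>T\<close> give a product that is nonnegative off
  \<open>T\<close>; doubling the third node gives a square. Since \<open>-1/23\<close> ends both
  intervals, the doubled node is always an outer one, as \<open>hermite_minorant\<close>
  requires.\<close>

lemma quartic_sign: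
  assumes "T = {-9/23<..<-1/23} \<or> T = {-1/23<..<7/23 :: real}"
  obtains d where "d = -9/23 \<or> d = 7/23"
    "\<And>t. t \<notin> T \<Longrightarrow> (t - (-9/23)) * (t - (-1/23)) * (t - 7/23) * (t - d) \<ge> 0"
proof -
  have *: "(t - p) * (t - q) \<ge> 0" if "t \<notin> {p<..<q}" "p \<le> q" for t p q :: real
    using that by (cases "t \<le> p") (auto intro: mult_nonpos_nonpos mult_nonneg_nonneg)
  from assms show thesis
  proof
    assume T: "T = {-9/23<..<-1/23}"
    show ?thesis
    proof (rule that[of "7/23"])
      fix t assume "t \<notin> T"
      then have "(t - (-9/23)) * (t - (-1/23)) * ((t - 7/23) * (t - 7/23)) \<ge> 0"
        unfolding T by (intro mult_nonneg_nonneg[OF * zero_le_square]) auto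
      then show "(t - (-9/23)) * (t - (-1/23)) * (t - 7/23) * (t - 7/23) \<ge> 0"
        by (simp only: mult.assoc)
    qed simp
  next
    assume T: "T = {-1/23<..<7/23}"
    show ?thesis
    proof (rule that[of "-9/23"])
      fix t assume "t \<notin> T"
      then have "(t - (-1/23)) * (t - 7/23) * ((t - (-9/23)) * (t - (-9/23))) \<ge> 0"
        unfolding T by (intro mult_nonneg_nonneg[OF * zero_le_square]) auto
      then show "(t - (-9/23)) * (t - (-1/23)) * (t - 7/23) * (t - (-9/23)) \<ge> 0"
        by (simp only: mult_ac)
    qed simp
  qed
qed

lemma target_energy_cong:
  "(\<And>t. t \<in> {-9/23, -1/23, 7/23} \<Longrightarrow> f t = h t) \<Longrightarrow> target_energy f = target_energy h"
  by (simp add: target_energy_def)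

text \<open>The excess over the target splits into three moment terms and the total of
  \<open>h\<close> minus the cubic over all pairs, all nonnegative; in the equality case each of
  them vanishes.\<close>

lemma lp_bound:
  fixes C :: "(real ^ 23) set"
  assumes T: "T = {-9/23<..<-1/23} \<or> T = {-1/23<..<7/23}"
    and h: "absolutely_monotone h"
    and C: "spherical_code C" "avoiding T C" "card C = 2048"
  shows "energy h C \<ge> target_energy h"
    and "\<lbrakk>energy h C = target_energy h; \<And>t. t \<in> {-1<..<1} \<Longrightarrow> (deriv ^^ 4) h t > 0\<rbrakk> \<Longrightarrow>
      power_sum 1 C = 0 \<and> power_sum 2 C - 2048\<^sup>2 / 23 = 0 \<and> power_sum 3 C - 3 / 25 * power_sum 1 C = 0 \<and>
      inner_products C \<subseteq> {-9/23, -1/23, 7/23}"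
proof -
  obtain d where d: "d = -9/23 \<or> d = 7/23"
    "\<And>t. t \<notin> T \<Longrightarrow> (t - (-9/23)) * (t - (-1/23)) * (t - 7/23) * (t - d) \<ge> 0"
    using quartic_sign[OF T] by blast
  have nodes: "-1 < (-9/23 :: real)" "(-9/23 :: real) < -1/23" "(-1/23 :: real) < 7/23" "(7/23 :: real) < 1"
    by simp_all
  obtain A\<^sub>0 A\<^sub>1 A\<^sub>2 A\<^sub>3 where
    interp: "\<And>t. t \<in> {-9/23, -1/23, 7/23} \<Longrightarrow> lp_cubic A\<^sub>0 A\<^sub>1 A\<^sub>2 A\<^sub>3 t = h t"
    and A: "0 \<le> A\<^sub>1" "0 \<le> A\<^sub>2" "0 \<le> A\<^sub>3"
    and le: "\<And>t. t \<in> {-1..<1} \<Longrightarrow> (t - (-9/23)) * (t - (-1/23)) * (t - 7/23) * (t - d) \<ge> 0 \<Longrightarrow>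
       lp_cubic A\<^sub>0 A\<^sub>1 A\<^sub>2 A\<^sub>3 t \<le> h t"
    and strict: "(\<And>t. t \<in> {-1<..<1} \<Longrightarrow> (deriv ^^ 4) h t > 0) \<Longrightarrow>
       0 < A\<^sub>1 \<and> 0 < A\<^sub>2 \<and> 0 < A\<^sub>3 \<and>
       (\<forall>t\<in>{-1..<1} - {-9/23, -1/23, 7/23}.
          (t - (-9/23)) * (t - (-1/23)) * (t - 7/23) * (t - d) \<ge> 0 \<longrightarrow> lp_cubic A\<^sub>0 A\<^sub>1 A\<^sub>2 A\<^sub>3 t < h t)"
    by (rule hermite_minorant[OF h nodes d(1)]) (rule that; blast)
  let ?f = "lp_cubic A\<^sub>0 A\<^sub>1 A\<^sub>2 A\<^sub>3"
  define m1 where "m1 = power_sum 1 C"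
  define m2 where "m2 = power_sum 2 C - 2048\<^sup>2 / 23"
  define m3 where "m3 = power_sum 3 C - 3 / 25 * power_sum 1 C"
  define gap where "gap = (\<Sum>(x, y)\<in>{(x, y). x \<in> C \<and> y \<in> C \<and> x \<noteq> y}. h (x \<bullet> y) - ?f (x \<bullet> y))"
  have m: "m1 \<ge> 0" "m2 \<ge> 0" "m3 \<ge> 0"
    unfolding m1_def m2_def m3_def by (rule lp_moments_nonneg[OF C(1,3)])+
  have fin: "finite C" using C(1) by (simp add: spherical_code_def)
  have ip: "x \<bullet> y \<in> {-1..<1}" "x \<bullet> y \<notin> T" if "x \<in> C" "y \<in> C" "x \<noteq> y" for x y
    using that C(1,2) inner_unit_bounds[of x y]
    by (auto simp: spherical_code_def subset_iff avoiding_def inner_products_def)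
  have pair: "h (x \<bullet> y) - ?f (x \<bullet> y) \<ge> 0" if "x \<in> C" "y \<in> C" "x \<noteq> y" for x y
    using le[OF ip(1) d(2)[OF ip(2)]] that by simp
  then have gap: "gap \<ge> 0" unfolding gap_def by (intro sum_nonneg) auto
  have "energy h C = energy ?f C + gap"
    unfolding gap_def energy_def by (simp add: case_prod_unfold sum_subtractf)
  also have "energy ?f C = target_energy h + A\<^sub>1 * m1 + A\<^sub>2 * (m2 + 10 / 23 * m1) + A\<^sub>3 * (m3 + 3 / 23 * m2 + 62 / 13225 * m1)"
    unfolding m1_def m2_def m3_def energy_lp_cubic[OF C(1,3)] using target_energy_cong[OF interp] by simp
  finally have E: "energy h C = target_energy h + A\<^sub>1 * m1 + A\<^sub>2 * (m2 + 10 / 23 * m1)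
      + A\<^sub>3 * (m3 + 3 / 23 * m2 + 62 / 13225 * m1) + gap" .
  have terms: "A\<^sub>1 * m1 \<ge> 0" "A\<^sub>2 * (m2 + 10 / 23 * m1) \<ge> 0" "A\<^sub>3 * (m3 + 3 / 23 * m2 + 62 / 13225 * m1) \<ge> 0"
    using A m by simp_all
  show "energy h C \<ge> target_energy h" using E terms gap by linarith
  assume eq: "energy h C = target_energy h" and pos: "\<And>t. t \<in> {-1<..<1} \<Longrightarrow> (deriv ^^ 4) h t > 0"
  note str = strict[OF pos]
  have z: "A\<^sub>1 * m1 = 0" "A\<^sub>2 * (m2 + 10 / 23 * m1) = 0"
    "A\<^sub>3 * (m3 + 3 / 23 * m2 + 62 / 13225 * m1) = 0" "gap = 0"
    using E eq terms gap by linarith+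
  \<comment> \<open>With positive coefficients the equations are solved in turn: \<open>m1\<close>,
    then \<open>m2\<close>, then \<open>m3\<close>.\<close>
  then have "m1 = 0" "m2 = 0" "m3 = 0" using str by auto
  moreover have "inner_products C \<subseteq> {-9/23, -1/23, 7/23}"
  proof
    fix t assume "t \<in> inner_products C"
    then obtain x y where xy: "x \<in> C" "y \<in> C" "x \<noteq> y" "t = x \<bullet> y" by (auto simp: inner_products_def)
    have "gap = 0 \<longleftrightarrow>
        (\<forall>p\<in>{(x, y). x \<in> C \<and> y \<in> C \<and> x \<noteq> y}. (\<lambda>(x, y). h (x \<bullet> y) - ?f (x \<bullet> y)) p = 0)"
      unfolding gap_def by (rule sum_nonneg_eq_0_iff[OF finite_pairs[OF fin]]) (use pair in auto)
    with z(4) xy have "h t = ?f t" by auto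
    show "t \<in> {-9/23, -1/23, 7/23}"
    proof (rule ccontr)
      assume "t \<notin> {-9/23, -1/23, 7/23}"
      with ip(1)[OF xy(1-3)] have "t \<in> {-1..<1} - {-9/23, -1/23, 7/23}" unfolding xy(4) by blast
      moreover have "t \<notin> T" using ip(2)[OF xy(1-3)] unfolding xy(4) .
      ultimately have "?f t < h t" using str d(2)[of t] by blast
      with \<open>h t = ?f t\<close> show False by simp
    qed
  qed
  ultimately show "power_sum 1 C = 0 \<and> power_sum 2 C - 2048\<^sup>2 / 23 = 0 \<and>
      power_sum 3 C - 3 / 25 * power_sum 1 C = 0 \<and> inner_products C \<subseteq> {-9/23, -1/23, 7/23}"
    unfolding m1_def m2_def m3_def by blast
qed

section \<open>Distance distributions and the optimal code\<close>

text \<open>The term \<open>g 1\<close> comes from \<open>y = x\<close>; since 1 is not in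
  \<open>S\<close>, the point \<open>x\<close> falls into none of the counted classes.\<close>

lemma sum_by_inner_product:
  fixes C :: "(real ^ 'n) set" and g :: "real \<Rightarrow> real"
  assumes C: "spherical_code C" "x \<in> C" and S: "finite S" "1 \<notin> S" "inner_products C \<subseteq> S"
  shows "(\<Sum>y\<in>C. g (x \<bullet> y)) = g 1 + (\<Sum>t\<in>S. real (card {y \<in> C. x \<bullet> y = t}) * g t)"
proof -
  have fin: "finite C" and x: "x \<bullet> x = 1"
    using C by (auto simp: spherical_code_def norm_eq_1)
  have img: "(\<lambda>y. x \<bullet> y) ` (C - {x}) \<subseteq> S"
    using C(2) S(3) by (auto simp: inner_products_def)
  have "(\<Sum>y\<in>C. g (x \<bullet> y)) = g 1 + (\<Sum>y\<in>C - {x}. g (x \<bullet> y))"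
    using fin C(2) x by (simp add: sum.remove)
  also have "(\<Sum>y\<in>C - {x}. g (x \<bullet> y)) = (\<Sum>t\<in>S. \<Sum>y | y \<in> C - {x} \<and> x \<bullet> y = t. g (x \<bullet> y))"
    using fin S(1) img by (intro sum.group[symmetric]) auto
  also have "\<dots> = (\<Sum>t\<in>S. real (card {y \<in> C. x \<bullet> y = t}) * g t)"
  proof (intro sum.cong refl)
    fix t assume "t \<in> S"
    then have "{y. y \<in> C - {x} \<and> x \<bullet> y = t} = {y \<in> C. x \<bullet> y = t}" using S(2) x by auto
    then show "(\<Sum>y | y \<in> C - {x} \<and> x \<bullet> y = t. g (x \<bullet> y)) = real (card {y \<in> C. x \<bullet> y = t}) * g t"
      by simp
  qed
  finally show ?thesis .
qed

text \<open>Seen from a point \<open>x\<close>, the three counts satisfy the linear equations given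
  by the moments of \<open>x \<bullet> y\<close> of orders 0, 1, 2, a Vandermonde system with
  distinct nodes. The summand 1 in each equation is the point \<open>x\<close> itself.\<close>

lemma counts_from_moments:
  fixes C :: "(real ^ 23) set"
  assumes C: "spherical_code C" "card C = 2048"
    and ip: "inner_products C \<subseteq> {-9/23, -1/23, 7/23}"
    and m1: "\<And>i. (\<Sum>y\<in>C. y $ i) = 0"
    and m2: "\<And>i j. (\<Sum>y\<in>C. y $ i * y $ j) = 2048 / 23 * delta i j"
  shows "\<forall>x\<in>C. card {y \<in> C. x \<bullet> y = -9/23} = 253 \<and>
    card {y \<in> C. x \<bullet> y = -1/23} = 1288 \<and> card {y \<in> C. x \<bullet> y = 7/23} = 506"
proof
  fix x assume x: "x \<in> C"
  define c where "c t = real (card {y \<in> C. x \<bullet> y = t})" for t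
  have sum: "(\<Sum>y\<in>C. g (x \<bullet> y)) = g 1 + (c (-9/23) * g (-9/23) + c (-1/23) * g (-1/23) + c (7/23) * g (7/23))"
    for g :: "real \<Rightarrow> real"
    using sum_by_inner_product[OF C(1) x _ _ ip, of g] by (simp add: c_def)
  have "(\<Sum>y\<in>C. x \<bullet> y) = (\<Sum>i\<in>UNIV. x $ i * (\<Sum>y\<in>C. y $ i))"
    unfolding inner_vec_def inner_real_def by (subst sum.swap) (simp add: sum_distrib_left)
  then have s1: "(\<Sum>y\<in>C. x \<bullet> y) = 0" by (simp add: m1)
  \<comment> \<open>The second moment matrix of \<open>C\<close> is 2048/23 times the identity, so
    its quadratic form at the unit vector \<open>x\<close> is 2048/23.\<close>
  have "(x \<bullet> y)\<^sup>2 = (\<Sum>i\<in>UNIV. \<Sum>j\<in>UNIV. x $ i * x $ j * (y $ i * y $ j))" for y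
    by (simp add: inner_vec_def power2_eq_square sum_product mult_ac)
  then have "(\<Sum>y\<in>C. (x \<bullet> y)\<^sup>2) = (\<Sum>y\<in>C. \<Sum>i\<in>UNIV. \<Sum>j\<in>UNIV. x $ i * x $ j * (y $ i * y $ j))"
    by simp
  also have "\<dots> = (\<Sum>i\<in>UNIV. \<Sum>j\<in>UNIV. x $ i * x $ j * (\<Sum>y\<in>C. y $ i * y $ j))"
    unfolding sum_distrib_left by (subst sum.swap, rule sum.cong[OF refl], rule sum.swap)
  also have "\<dots> = 2048 / 23 * (\<Sum>i\<in>UNIV. \<Sum>j\<in>UNIV. delta i j * (x $ i * x $ j))"
    by (simp add: m2 sum_distrib_left mult_ac)
  also have "\<dots> = 2048 / 23"
    using unit_sum_squares[of x] C(1) x by (simp add: sum_delta spherical_code_def subset_iff)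
  finally have s2: "(\<Sum>y\<in>C. (x \<bullet> y)\<^sup>2) = 2048 / 23" .
  have "1 + (c (-9/23) + c (-1/23) + c (7/23)) = 2048"
    using sum[of "\<lambda>_. 1"] C(2) by simp
  moreover have "1 + (c (-9/23) * (-9/23) + c (-1/23) * (-1/23) + c (7/23) * (7/23)) = 0"
    using sum[of "\<lambda>t. t"] s1 by simp
  moreover have "1 + (c (-9/23) * (81/529) + c (-1/23) * (1/529) + c (7/23) * (49/529)) = 2048 / 23"
    using sum[of "\<lambda>t. t\<^sup>2"] s2 by (simp add: power2_eq_square)
  ultimately have "c (-9/23) = 253" "c (-1/23) = 1288" "c (7/23) = 506" by linarith+
  then show "card {y \<in> C. x \<bullet> y = -9/23} = 253 \<and> card {y \<in> C. x \<bullet> y = -1/23} = 1288 \<and>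
      card {y \<in> C. x \<bullet> y = 7/23} = 506"
    by (simp add: c_def)
qed

text \<open>All three counts are positive, so each candidate value occurs and the inclusion becomes
  an equality; the values are already listed in increasing order.\<close>

lemma distance_distributionI:
  fixes C :: "(real ^ 23) set"
  assumes C: "spherical_code C" "C \<noteq> {}" and ip: "inner_products C \<subseteq> {-9/23, -1/23, 7/23}"
    and counts: "\<forall>x\<in>C. card {y \<in> C. x \<bullet> y = -9/23} = 253 \<and>
      card {y \<in> C. x \<bullet> y = -1/23} = 1288 \<and> card {y \<in> C. x \<bullet> y = 7/23} = 506"
  shows "inner_products C = {-9/23, -1/23, 7/23}" "has_distance_distribution C [253, 1288, 506]"
proof -
  obtain x where x: "x \<in> C" using C(2) by blast
  then have xx: "x \<bullet> x = 1" using C(1) by (auto simp: spherical_code_def norm_eq_1)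
  have "t \<in> inner_products C" if "t \<noteq> 1" "card {y \<in> C. x \<bullet> y = t} > 0" for t
  proof -
    from that(2) obtain y where "y \<in> C" "x \<bullet> y = t" by (auto simp: card_gt_0_iff)
    with x xx that(1) show ?thesis by (auto simp: inner_products_def)
  qed
  from this[of "-9/23"] this[of "-1/23"] this[of "7/23"] bspec[OF counts x] ip
  show eq: "inner_products C = {-9/23, -1/23, 7/23}" by auto
  have "sorted_list_of_set (set [-9/23, -1/23, 7/23 :: real]) = [-9/23, -1/23, 7/23]"
    by (rule sorted_list_of_set.idem_if_sorted_distinct) auto
  then have sorted: "sorted_list_of_set {-9/23, -1/23, 7/23 :: real} = [-9/23, -1/23, 7/23]"
    by simp
  have "map (\<lambda>t. card {y \<in> C. z \<bullet> y = t}) [-9/23, -1/23, 7/23] = [253, 1288, 506]" if "z \<in> C" for z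
    using bspec[OF counts that] by (simp only: list.map)
  moreover have "card {y \<in> C. z \<bullet> y = t} = card {y \<in> C. z' \<bullet> y = t}"
    if "t \<in> {-9/23, -1/23, 7/23}" "z \<in> C" "z' \<in> C" for t z z'
    using that(1) bspec[OF counts that(2)] bspec[OF counts that(3)]
    by (elim insertE emptyE) (simp_all only:)
  ultimately show "has_distance_distribution C [253, 1288, 506]"
    unfolding has_distance_distribution_def distance_invariant_def eq sorted by blast
qed

lemma energy_eq_target:
  fixes C :: "(real ^ 23) set"
  assumes C: "spherical_code C" "card C = 2048" and ip: "inner_products C \<subseteq> {-9/23, -1/23, 7/23}"
    and counts: "\<forall>x\<in>C. card {y \<in> C. x \<bullet> y = -9/23} = 253 \<and>
      card {y \<in> C. x \<bullet> y = -1/23} = 1288 \<and> card {y \<in> C. x \<bullet> y = 7/23} = 506"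
  shows "energy h C = target_energy h"
proof -
  have "(\<Sum>y\<in>C. h (x \<bullet> y)) = h 1 + (253 * h (-9/23) + 1288 * h (-1/23) + 506 * h (7/23))" if "x \<in> C" for x
    using sum_by_inner_product[OF C(1) that _ _ ip, of h] bspec[OF counts that] by simp
  then have "(\<Sum>x\<in>C. \<Sum>y\<in>C. h (x \<bullet> y)) = 2048 * h 1 + target_energy h"
    using C(2) by (simp add: target_energy_def algebra_simps)
  moreover have "(\<Sum>x\<in>C. \<Sum>y\<in>C. h (x \<bullet> y)) = energy h C + 2048 * h 1"
    using C by (subst sum_pairs) (auto simp: spherical_code_def)
  ultimately show ?thesis by simp
qed

section \<open>The spherical code of the dual Golay code\<close>

lemma sphere_embed_inner:
  "sphere_embed c \<bullet> sphere_embed c' = (real CARD('n) - 2 * real (weight (c + c'))) / CARD('n)"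
  for c c' :: "bit ^ 'n"
proof -
  \<comment> \<open>Two signs multiply to -1 exactly where the words differ, and over
    \<open>bit\<close> these positions are the support of the sum.\<close>
  have "(c + c') $ i = 1 \<longleftrightarrow> c $ i \<noteq> c' $ i" for i
    by (cases "c $ i"; cases "c' $ i") simp_all
  then have "sphere_embed c $ i * sphere_embed c' $ i = (1 - 2 * of_bool ((c + c') $ i = 1)) / CARD('n)" for i
    by (auto simp: sphere_embed_def)
  then have "sphere_embed c \<bullet> sphere_embed c' = (\<Sum>i\<in>UNIV. (1 - 2 * of_bool ((c + c') $ i = 1)) / CARD('n))"
    by (simp add: inner_vec_def)
  also have "\<dots> = (\<Sum>i\<in>UNIV. 1 - 2 * of_bool ((c + c') $ i = 1)) / CARD('n)"
    by (rule sum_divide_distrib[symmetric])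
  also have "(\<Sum>i\<in>UNIV. 1 - 2 * of_bool ((c + c') $ i = 1)) = real CARD('n) - 2 * real (weight (c + c'))"
    by (simp add: sum_subtractf weight_def flip: sum_distrib_left)
  finally show ?thesis .
qed

lemma inj_sphere_embed: "inj (sphere_embed :: bit ^ 'n \<Rightarrow> real ^ 'n)"
proof (rule injI)
  fix c c' :: "bit ^ 'n" assume "sphere_embed c = sphere_embed c'"
  then have eq: "sphere_embed c $ i = sphere_embed c' $ i" for i by simp
  have "c $ i = 1 \<longleftrightarrow> c' $ i = 1" for i
    using eq[of i]
    by (simp add: sphere_embed_def split: if_splits)
  then show "c = c'" by (metis bit_not_one_iff vec_eq_iff)
qed

lemma card_C_G: "card C_G = 2048"
  unfolding C_G_def using inj_sphere_embed card_dual_golay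
  by (subst card_image) (auto intro: inj_on_subset)

lemma spherical_code_C_G: "spherical_code C_G"
proof -
  have "norm (sphere_embed c) = 1" for c :: "bit ^ 23"
    using sphere_embed_inner[of c c] by (simp add: norm_eq_1 vec_bit_add_self weight_def)
  moreover have "finite C_G" using card_C_G by (intro card_ge_0_finite) simp
  ultimately show ?thesis by (auto simp: spherical_code_def C_G_def)
qed

text \<open>Translation by the word of \<open>x\<close> preserves the linear code and carries the
  words of weight \<open>w\<close> to those at Hamming distance \<open>w\<close> from that
  word.\<close>

lemma card_C_G_inner:
  assumes "x \<in> C_G"
  shows "card {y \<in> C_G. x \<bullet> y = (23 - 2 * real w) / 23} = card {c \<in> dual_code golay_code. weight c = w}"
proof -
  from assms obtain c where c: "c \<in> dual_code golay_code" "x = sphere_embed c" by (auto simp: C_G_def)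
  have "bij_betw (\<lambda>d. sphere_embed (c + d)) {d \<in> dual_code golay_code. weight d = w}
      {y \<in> C_G. x \<bullet> y = (23 - 2 * real w) / 23}"
    unfolding bij_betw_def
  proof
    show "inj_on (\<lambda>d. sphere_embed (c + d)) {d \<in> dual_code golay_code. weight d = w}"
      by (rule inj_onI) (simp only: inj_eq[OF inj_sphere_embed] add_left_cancel)
    have cc: "c + (c + d) = d" for d
      by (simp only: add.assoc[symmetric] vec_bit_add_self add_0_left)
    show "(\<lambda>d. sphere_embed (c + d)) ` {d \<in> dual_code golay_code. weight d = w}
        = {y \<in> C_G. x \<bullet> y = (23 - 2 * real w) / 23}"
    proof (intro set_eqI iffI)
      fix y assume "y \<in> (\<lambda>d. sphere_embed (c + d)) ` {d \<in> dual_code golay_code. weight d = w}"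
      then obtain d where d: "d \<in> dual_code golay_code" "weight d = w" "y = sphere_embed (c + d)" by blast
      then show "y \<in> {y \<in> C_G. x \<bullet> y = (23 - 2 * real w) / 23}"
        using c dual_code_add[OF c(1) d(1)] by (simp add: C_G_def sphere_embed_inner cc)
    next
      fix y assume y: "y \<in> {y \<in> C_G. x \<bullet> y = (23 - 2 * real w) / 23}"
      then obtain e where e: "e \<in> dual_code golay_code" "y = sphere_embed e" by (auto simp: C_G_def)
      then have "weight (c + e) = w" using y c by (simp add: sphere_embed_inner)
      with e show "y \<in> (\<lambda>d. sphere_embed (c + d)) ` {d \<in> dual_code golay_code. weight d = w}"
        using dual_code_add[OF c(1) e(1)] by (intro image_eqI[of _ _ "c + e"]) (simp_all add: cc)
    qed
  qed
  then show ?thesis by (rule bij_betw_same_card[symmetric])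
qed

lemma C_G_counts:
  "\<forall>x\<in>C_G. card {y \<in> C_G. x \<bullet> y = -9/23} = 253 \<and> card {y \<in> C_G. x \<bullet> y = -1/23} = 1288 \<and>
    card {y \<in> C_G. x \<bullet> y = 7/23} = 506"
proof
  fix x assume x: "x \<in> C_G"
  show "card {y \<in> C_G. x \<bullet> y = -9/23} = 253 \<and> card {y \<in> C_G. x \<bullet> y = -1/23} = 1288 \<and>
      card {y \<in> C_G. x \<bullet> y = 7/23} = 506"
    using card_C_G_inner[OF x, of 16] card_C_G_inner[OF x, of 12] card_C_G_inner[OF x, of 8]
    by (simp add: card_dual_golay_weight weight_counts)
qed

lemma inner_products_C_G_subset: "inner_products C_G \<subseteq> {-9/23, -1/23, 7/23}"
proof
  fix t assume "t \<in> inner_products C_G"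
  then obtain c c' where c: "c \<in> dual_code golay_code" "c' \<in> dual_code golay_code"
    "sphere_embed c \<noteq> sphere_embed c'" "t = sphere_embed c \<bullet> sphere_embed c'"
    by (auto simp: inner_products_def C_G_def)
  have "c + c' \<noteq> 0"
  proof
    assume "c + c' = 0"
    then have "c + c' + c' = c'" by (simp only: add_0_left)
    then have "c = c'" by (simp only: add.assoc vec_bit_add_self add_0_right)
    with c show False by simp
  qed
  then have "weight (c + c') \<in> {8, 12, 16}"
    using dual_golay_weight_cases dual_code_add[OF c(1,2)] by blast
  then show "t \<in> {-9/23, -1/23, 7/23}"
    unfolding c(4) sphere_embed_inner by auto
qed

theorem theorem7p7:
  fixes T :: "real set"
  assumes "T = {-9/23<..<-1/23} \<or> T = {-1/23<..<7/23}"
  shows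
    "(\<forall>h. absolutely_monotone h \<and> (\<forall>t\<in>{-1<..<1}. (deriv ^^ 4) h t > 0) \<longrightarrow>
        min_energy TYPE(23) h 2048 T
          = 2048 * (253 * h (-9/23) + 1288 * h (-1/23) + 506 * h (7/23)) \<and>
        (\<forall>C :: (real ^ 23) set. spherical_code C \<and> avoiding T C \<and> card C = 2048 \<longrightarrow>
           energy h C \<ge> min_energy TYPE(23) h 2048 T \<and>
           (energy h C = min_energy TYPE(23) h 2048 T \<longrightarrow>
              spherical_design 3 C \<and>
              inner_products C = {-9/23, -1/23, 7/23} \<and>
              has_distance_distribution C [253, 1288, 506])))
     \<and> universally_optimal T C_G \<and> card C_G = 2048
     \<and> inner_products C_G = {-9/23, -1/23, 7/23}
     \<and> has_distance_distribution C_G [253, 1288, 506]"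
proof -
  have ne: "C_G \<noteq> {}" using card_C_G by auto
  note C_G = distance_distributionI[OF spherical_code_C_G ne inner_products_C_G_subset C_G_counts]
  note E_C_G = energy_eq_target[OF spherical_code_C_G card_C_G inner_products_C_G_subset C_G_counts]
  have avoid: "avoiding T C_G"
    using assms unfolding avoiding_def C_G(1) by auto
  \<comment> \<open>The \<open>LEAST\<close> is genuine: \<open>C_G\<close> attains the value, and
    the linear programming bound puts all admissible energies above it.\<close>
  have min: "min_energy TYPE(23) h 2048 T = target_energy h" if h: "absolutely_monotone h" for h
    unfolding min_energy_def
  proof (rule Least_equality)
    show "\<exists>C :: (real ^ 23) set. spherical_code C \<and> avoiding T C \<and> card C = 2048 \<and> target_energy h = energy h C"
      using spherical_code_C_G avoid card_C_G E_C_G by metis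
    show "target_energy h \<le> e"
      if "\<exists>C :: (real ^ 23) set. spherical_code C \<and> avoiding T C \<and> card C = 2048 \<and> e = energy h C" for e
      using that lp_bound(1)[OF assms h] by blast
  qed
  have opt: "universally_optimal T C_G"
    unfolding universally_optimal_def E_C_G card_C_G
    using spherical_code_C_G avoid lp_bound(1)[OF assms] by blast
  have equality: "spherical_design 3 C \<and> inner_products C = {-9/23, -1/23, 7/23} \<and>
      has_distance_distribution C [253, 1288, 506]"
    if h: "absolutely_monotone h" and pos: "\<forall>t\<in>{-1<..<1}. (deriv ^^ 4) h t > 0"
      and C: "spherical_code C" "avoiding T C" "card C = 2048" and eq: "energy h C = target_energy h"
    for h and C :: "(real ^ 23) set"
  proof -
    have ne: "C \<noteq> {}" using C(3) by auto
    have eqs: "power_sum 1 C = 0" "power_sum 2 C - 2048\<^sup>2 / 23 = 0" "power_sum 3 C - 3 / 25 * power_sum 1 C = 0"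
      and ip: "inner_products C \<subseteq> {-9/23, -1/23, 7/23}"
      using lp_bound(2)[OF assms h C eq] pos by blast+
    note mom = lp_moments_eq_0D[OF C(1,3) eqs]
    have "spherical_design 3 C"
      by (rule spherical_design_3I[OF C(1) ne]) (simp_all add: mom C(3) delta_def)
    moreover note distance_distributionI[OF C(1) ne ip counts_from_moments[OF C(1,3) ip mom(1,2)]]
    ultimately show ?thesis by blast
  qed
  show ?thesis
    unfolding target_energy_def[symmetric]
  proof (intro conjI allI impI; (elim conjE)?)
    fix h assume h: "absolutely_monotone h" "\<forall>t\<in>{-1<..<1}. (deriv ^^ 4) h t > 0"
    show "min_energy TYPE(23) h 2048 T = target_energy h" by (rule min[OF h(1)])
    fix C :: "(real ^ 23) set" assume C: "spherical_code C" "avoiding T C" "card C = 2048"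
    show "min_energy TYPE(23) h 2048 T \<le> energy h C"
      unfolding min[OF h(1)] by (rule lp_bound(1)[OF assms h(1) C])
    assume "energy h C = min_energy TYPE(23) h 2048 T"
    note eq = equality[OF h C this[unfolded min[OF h(1)]]]
    show "spherical_design 3 C" "inner_products C = {-9/23, -1/23, 7/23}"
      "has_distance_distribution C [253, 1288, 506]"
      using eq by blast+
  qed (use opt card_C_G C_G in blast)+
qed

end
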